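(* Let $\mu,M$ be positive integers, let $\widehat\mu:=\min\{\mu,M+1\}$, and let $s$ be an integer with $0\le s\le\widehat\mu$. Let $\theta>-1$, $\sigma\in\mathbb{R}$, $\beta>-1$ and $0<\gamma<1$. If $u\in\mathcal{A}_{\theta,\sigma,\gamma,\beta}^{\mu}(\Lambda)$, then $$\big\|\mathscr{D}_{\theta,\sigma,\gamma,\beta}^{\,s}\big(u-\Pi_M^{\theta,\sigma,\gamma,\beta}u\big)\big\|_{\varrho^{\theta+s,\sigma+s,\gamma,\beta}}\le\left[\frac{(M-\widehat\mu+1)!}{(M-s+1)!}\right]^{1/2}\big\|\mathscr{D}_{\theta,\sigma,\gamma,\beta}^{\,\widehat\mu}u\big\|_{\varrho^{\theta+\widehat\mu,\sigma+\widehat\mu,\gamma,\beta}}.$$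
   Context: $\Lambda=(0,\infty)$. For $\theta>-1$, $\sigma\in\mathbb{R}$, $\beta>-1$, $0<\gamma<1$ set $$\varrho^{\theta,\sigma,\gamma,\beta}(x):=\gamma(\beta+1)^{\theta+1}x^{\gamma(\sigma+1)-1}e^{-(\beta+1)x^\gamma},\qquad x\in\Lambda.$$ For a weight $\varrho$, $L^2_\varrho(\Lambda)$ is the weighted space with norm $\|v\|_\varrho=(\int_0^\infty|v|^2\varrho\,dx)^{1/2}$ and inner product $(v,w)_\varrho=\int_0^\infty vw\varrho\,dx$ (real-valued functions). The scaled mapped derivative is $$\mathscr{D}_{\theta,\sigma,\gamma,\beta}u:=x^{\frac{\gamma(\theta-\sigma)}{2}}\,\mathscr{D}_{\gamma,\beta}\Big(x^{-\frac{\gamma(\theta-\sigma)}{2}}u\Big),\qquad \mathscr{D}_{\gamma,\beta}u:=\frac{x^{1-\gamma}}{\gamma(\beta+1)}\,\partial_xu,$$ with $\partial_x$ understood in the weak sense; $\mathscr{D}_{\theta,\sigma,\gamma,\beta}^{\,r}$ is its $r$-fold iterate and $\mathscr{D}_{\theta,\sigma,\gamma,\beta}^{\,0}v=v$. For an integer $\mu\ge 0$, $$\mathcal{A}_{\theta,\sigma,\gamma,\beta}^{\mu}(\Lambda):=\big\{v\in L^2_{\varrho^{\theta,\sigma,\gamma,\beta}}(\Lambda):\ \mathscr{D}_{\theta,\sigma,\gamma,\beta}^{\,r}v\in L^2_{\varrho^{\theta+r,\sigma+r,\gamma,\beta}}(\Lambda),\ 1\le r\le\mu\big\}.$$ With $\eta:=\gamma(\theta-\sigma)/2$,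 let $\mathbb{P}_M^{\eta,\gamma}:=\{x^{\eta}q(x):q\in\operatorname{span}\{1,x^\gamma,\dots,x^{M\gamma}\}\}$. For $u\in L^2_{\varrho^{\theta,\sigma,\gamma,\beta}}(\Lambda)$, $\Pi_M^{\theta,\sigma,\gamma,\beta}u\in\mathbb{P}_M^{\eta,\gamma}$ is the weighted orthogonal projection, defined by $(u-\Pi_M^{\theta,\sigma,\gamma,\beta}u,w)_{\varrho^{\theta,\sigma,\gamma,\beta}}=0$ for all $w\in\mathbb{P}_M^{\eta,\gamma}$. *)

theory Defs
  imports "HOL-Analysis.Analysis"
begin

text \<open>
  Functions on the half-line \<open>\<Lambda> = (0, \<infinity>)\<close> are represented by total functions on the reals.
  Their values outside \<open>\<Lambda>\<close> are irrelevant, as are changes on null sets.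
\<close>

definition half_line :: "real set" where
  "half_line = {0<..}"

definition weight :: "real \<Rightarrow> real \<Rightarrow> real \<Rightarrow> real \<Rightarrow> real \<Rightarrow> real" where
  "weight \<theta> \<sigma> \<gamma> \<beta> x =
     \<gamma> * (\<beta> + 1) powr (\<theta> + 1) * x powr (\<gamma> * (\<sigma> + 1) - 1) * exp (- (\<beta> + 1) * x powr \<gamma>)"

definition weighted_L2 :: "(real \<Rightarrow> real) \<Rightarrow> (real \<Rightarrow> real) set" where
  "weighted_L2 \<rho> =
     {v \<in> borel_measurable (lebesgue_on half_line).
        integrable (lebesgue_on half_line) (\<lambda>x. \<bar>v x\<bar>\<^sup>2 * \<rho> x)}"

definition weighted_inner :: "(real \<Rightarrow> real) \<Rightarrow> (real \<Rightarrow> real) \<Rightarrow> (real \<Rightarrow> real) \<Rightarrow> real" where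
  "weighted_inner \<rho> v w = (LINT x|lebesgue_on half_line. v x * w x * \<rho> x)"

text \<open>Only meaningful on \<open>weighted_L2\<close>: the integral of a non-integrable function is 0.\<close>

definition weighted_norm :: "(real \<Rightarrow> real) \<Rightarrow> (real \<Rightarrow> real) \<Rightarrow> real" where
  "weighted_norm \<rho> v = sqrt (LINT x|lebesgue_on half_line. \<bar>v x\<bar>\<^sup>2 * \<rho> x)"

definition locally_integrable :: "(real \<Rightarrow> real) \<Rightarrow> bool" where
  "locally_integrable f \<longleftrightarrow>
     (\<forall>K. compact K \<and> K \<subseteq> half_line \<longrightarrow> f absolutely_integrable_on K)"

definition test_function :: "(real \<Rightarrow> real) \<Rightarrow> bool" where
  "test_function \<phi> \<longleftrightarrow>
     (\<forall>k x. ((deriv ^^ k) \<phi>) field_differentiable (at x)) \<and>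
     compact (closure {x. \<phi> x \<noteq> 0}) \<and> closure {x. \<phi> x \<noteq> 0} \<subseteq> half_line"

definition has_weak_deriv :: "(real \<Rightarrow> real) \<Rightarrow> (real \<Rightarrow> real) \<Rightarrow> bool" where
  "has_weak_deriv f g \<longleftrightarrow>
     locally_integrable f \<and> locally_integrable g \<and>
     (\<forall>\<phi>. test_function \<phi> \<longrightarrow>
        (LINT x|lebesgue_on half_line. f x * deriv \<phi> x) =
        - (LINT x|lebesgue_on half_line. g x * \<phi> x))"

definition weakly_differentiable :: "(real \<Rightarrow> real) \<Rightarrow> bool" where
  "weakly_differentiable f \<longleftrightarrow> (\<exists>g. has_weak_deriv f g)"

text \<open>
  A representative of the weak derivative, which is unique almost everywhere on \<open>\<Lambda>\<close>.
  The choice is the same for functions that agree almost everywhere on \<open>\<Lambda>\<close>.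
  The value is unspecified if \<open>f\<close> is not weakly differentiable.
\<close>

definition weak_deriv :: "(real \<Rightarrow> real) \<Rightarrow> (real \<Rightarrow> real)" where
  "weak_deriv f = (SOME g. has_weak_deriv f g)"

definition mapped_deriv :: "real \<Rightarrow> real \<Rightarrow> (real \<Rightarrow> real) \<Rightarrow> (real \<Rightarrow> real)" where
  "mapped_deriv \<gamma> \<beta> u = (\<lambda>x. x powr (1 - \<gamma>) / (\<gamma> * (\<beta> + 1)) * weak_deriv u x)"

definition scaled_mapped_deriv ::
    "real \<Rightarrow> real \<Rightarrow> real \<Rightarrow> real \<Rightarrow> (real \<Rightarrow> real) \<Rightarrow> (real \<Rightarrow> real)" where
  "scaled_mapped_deriv \<theta> \<sigma> \<gamma> \<beta> u =
     (\<lambda>x. x powr (\<gamma> * (\<theta> - \<sigma>) / 2) *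
          mapped_deriv \<gamma> \<beta> (\<lambda>y. y powr (- (\<gamma> * (\<theta> - \<sigma>) / 2)) * u y) x)"

definition iterated_deriv ::
    "real \<Rightarrow> real \<Rightarrow> real \<Rightarrow> real \<Rightarrow> nat \<Rightarrow> (real \<Rightarrow> real) \<Rightarrow> (real \<Rightarrow> real)" where
  "iterated_deriv \<theta> \<sigma> \<gamma> \<beta> r = scaled_mapped_deriv \<theta> \<sigma> \<gamma> \<beta> ^^ r"

text \<open>All weak derivatives occurring in the \<open>r\<close>-fold iterate exist.\<close>

definition iterated_deriv_exists ::
    "real \<Rightarrow> real \<Rightarrow> real \<Rightarrow> real \<Rightarrow> nat \<Rightarrow> (real \<Rightarrow> real) \<Rightarrow> bool" where
  "iterated_deriv_exists \<theta> \<sigma> \<gamma> \<beta> r v \<longleftrightarrow>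
     (\<forall>j<r. weakly_differentiable
        (\<lambda>x. x powr (- (\<gamma> * (\<theta> - \<sigma>) / 2)) * iterated_deriv \<theta> \<sigma> \<gamma> \<beta> j v x))"

definition A_space :: "real \<Rightarrow> real \<Rightarrow> real \<Rightarrow> real \<Rightarrow> nat \<Rightarrow> (real \<Rightarrow> real) set" where
  "A_space \<theta> \<sigma> \<gamma> \<beta> \<mu> =
     {v \<in> weighted_L2 (weight \<theta> \<sigma> \<gamma> \<beta>).
        \<forall>r. 1 \<le> r \<and> r \<le> \<mu> \<longrightarrow>
          iterated_deriv_exists \<theta> \<sigma> \<gamma> \<beta> r v \<and>
          iterated_deriv \<theta> \<sigma> \<gamma> \<beta> r v
            \<in> weighted_L2 (weight (\<theta> + real r) (\<sigma> + real r) \<gamma> \<beta>)}"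

definition P_space :: "nat \<Rightarrow> real \<Rightarrow> real \<Rightarrow> (real \<Rightarrow> real) set" where
  "P_space M \<eta> \<gamma> =
     {(\<lambda>x. x powr \<eta> * (\<Sum>k\<le>M. c k * x powr (real k * \<gamma>))) | c :: nat \<Rightarrow> real. True}"

text \<open>
  The elements of \<open>P_space\<close> are given by one formula on all reals, so the projection is unique
  as a function on the reals and not merely almost everywhere on \<open>\<Lambda>\<close>.
\<close>

definition proj ::
    "nat \<Rightarrow> real \<Rightarrow> real \<Rightarrow> real \<Rightarrow> real \<Rightarrow> (real \<Rightarrow> real) \<Rightarrow> (real \<Rightarrow> real)" where
  "proj M \<theta> \<sigma> \<gamma> \<beta> u =
     (THE p. p \<in> P_space M (\<gamma> * (\<theta> - \<sigma>) / 2) \<gamma> \<and>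
        (\<forall>w \<in> P_space M (\<gamma> * (\<theta> - \<sigma>) / 2) \<gamma>.
           weighted_inner (weight \<theta> \<sigma> \<gamma> \<beta>) (\<lambda>x. u x - p x) w = 0))"

end

theory Submission
  imports Defs "HOL-Computational_Algebra.Polynomial" "HOL-Real_Asymp.Real_Asymp"
begin

text \<open>
  Writing \<open>u = x powr \<eta> * F\<close> with \<open>\<eta> = \<gamma> (\<theta> - \<sigma>) / 2\<close> and \<open>y = (\<beta> + 1) x powr \<gamma>\<close> turns the scaled mapped
  derivative into \<open>d/dy\<close>, the weights into the Laguerre weights \<open>y powr (\<theta> + r) * exp (- y)\<close>, and the
  projection into the orthogonal projection onto polynomials in \<open>y\<close> of degree at most \<open>M\<close>.
  Integration by parts shows that if \<open>F\<close> is orthogonal to all polynomials of degree less than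
  \<open>N + 1\<close>, then \<open>F'\<close> is orthogonal, for the next weight, to those of degree less than \<open>N\<close>. The estimate
  is the product of the Poincare inequalities \<open>N * \<parallel>F\<parallel>\<^sup>2 \<le> \<parallel>F'\<parallel>\<^sup>2\<close>, valid for \<open>F\<close> orthogonal to all
  polynomials of degree less than \<open>N\<close>, along the derivatives of the error, followed by Pythagoras for
  the last derivative. The Poincare inequality is elementary for polynomials, since the Laguerre
  operator maps \<open>y ^ k\<close> to \<open>k * y ^ k\<close> plus lower terms; it extends to all \<open>F\<close> by density of the polynomials.
\<close>

subsection \<open>Flat functions and test functions\<close>

text \<open>Weak derivatives are tested only against smooth functions with compact support in the
  half-line, whereas the argument must test against
  \<open>y powr (\<alpha> + 1) * exp (- y) * q y\<close>, which reaches both 0 and infinity. A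
  cutoff bridges this gap. Its derivative is O(1/x), and the test object divided by \<open>x\<close>
  is a multiple of \<open>q y\<close> times the weight of index \<alpha>; so square integrability of
  \<open>F\<close> alone makes the boundary contributions vanish, without any study of traces or
  decay. The weak derivative is a chosen representative, so each iterate is known only almost
  everywhere, and derivatives are compared through uniqueness. The constant comes from the degrees:
  the \<open>j\<close>-th derivative of the error is orthogonal to all polynomials of degree less
  than \<open>M + 1 - j\<close>, which is also its Poincare factor, and the product over
  \<open>s \<le> j < m\<close> is \<open>(M + 1 - s)! / (M + 1 - m)!\<close>. Explicit Laguerre
  polynomials and infinite expansions are avoided: only leading coefficients enter, and a general
  function is replaced by its projection to a sufficiently high finite degree.\<close>

definition flat :: "real \<Rightarrow> nat \<Rightarrow> real \<Rightarrow> real" where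
  "flat c k u = (if u > 0 then exp (- c / u) / u ^ k else 0)"

lemma exp_minus_le:
  fixes z :: real
  assumes "z > 0"
  shows "exp (- z) \<le> fact n / z ^ n"
proof -
  have "z ^ n / fact n \<le> exp z"
    using sum_le_suminf[OF summable_exp_generic[of z], of "{n}"] assms
    by (simp add: exp_def divide_inverse mult.commute)
  then show ?thesis
    using assms by (simp add: exp_minus field_simps)
qed

text \<open>Taking the term of order \<open>k + 2\<close> of the exponential series absorbs the pole
  \<open>1 / u ^ k\<close> and leaves a factor \<open>u\<^sup>2\<close>, which is what makes the
  difference quotient at 0 vanish.\<close>

lemma flat_le:
  assumes "c > 0"
  shows "\<bar>flat c k u\<bar> \<le> fact (k + 2) / c ^ (k + 2) * u\<^sup>2"
proof (cases "u > 0")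
  case True
  have "exp (- (c / u)) \<le> fact (k + 2) / (c / u) ^ (k + 2)"
    using assms True by (intro exp_minus_le) simp
  then have "exp (- c / u) / u ^ k \<le> fact (k + 2) / (c / u) ^ (k + 2) / u ^ k"
    using True by (intro divide_right_mono) auto
  also have "\<dots> = fact (k + 2) / c ^ (k + 2) * u\<^sup>2"
  proof -
    have "F / (c / u) ^ (k + 2) / u ^ k = F / c ^ (k + 2) * u\<^sup>2" for F
      using True by (simp add: power_divide power_add power2_eq_square)
    then show ?thesis .
  qed
  finally show ?thesis
    using True by (simp add: flat_def)
qed (use assms in \<open>simp add: flat_def\<close>)

text \<open>The parameter \<open>k\<close> exists for the sake of this formula: differentiation
  stays in the span of the \<open>flat c k\<close>, so smoothness of all orders follows by
  iteration. Only the point 0, where the two branches meet, needs the quadratic bound.\<close>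

lemma flat_has_field_derivative:
  assumes "c > 0"
  shows "(flat c k has_field_derivative c * flat c (k + 2) u - real k * flat c (k + 1) u) (at u)"
proof -
  consider "u > 0" | "u < 0" | "u = 0" by linarith
  then show ?thesis
  proof cases
    case 1
    have "((\<lambda>u. exp (- c / u) / u ^ k) has_field_derivative
        (exp (- c / u) * (c / u\<^sup>2) * u ^ k - exp (- c / u) * (real k * u ^ (k - 1))) / (u ^ k * u ^ k)) (at u)"
      using 1 by (auto intro!: derivative_eq_intros simp: power2_eq_square)
    \<comment> \<open>For \<open>k = 0\<close> the exponent \<open>k - 1\<close> truncates to 0, but
      the factor \<open>real k\<close> vanishes.\<close>
    moreover have "real k * u ^ (k - 1) = real k * u ^ k / u"
      using 1 by (cases k) auto
    then have "(exp (- c / u) * (c / u\<^sup>2) * u ^ k - exp (- c / u) * (real k * u ^ (k - 1))) / (u ^ k * u ^ k) =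
        c * flat c (k + 2) u - real k * flat c (k + 1) u"
      using 1 by (simp only: flat_def) (simp add: diff_divide_distrib power2_eq_square mult_ac)
    ultimately have "((\<lambda>u. exp (- c / u) / u ^ k) has_field_derivative
        c * flat c (k + 2) u - real k * flat c (k + 1) u) (at u)"
      by simp
    then show ?thesis
      using 1 by (rule_tac has_field_derivative_transform_within_open[where S = "{0<..}"])
        (auto simp: flat_def)
  next
    case 2
    have "((\<lambda>u. 0) has_field_derivative 0) (at u)" by simp
    then have "(flat c k has_field_derivative 0) (at u)"
      by (rule has_field_derivative_transform_within_open[where S = "{..<0}"])
        (use 2 in \<open>auto simp: flat_def\<close>)
    then show ?thesis
      using 2 by (simp add: flat_def)
  next
    case 3
    define C where "C = fact (k + 2) / c ^ (k + 2)"
    have "((\<lambda>h. flat c k h / h) \<longlongrightarrow> 0) (at 0)"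
    proof (rule Lim_null_comparison)
      have "norm (flat c k h / h) \<le> C * \<bar>h\<bar>" if "h \<noteq> 0" for h
      proof -
        have "\<bar>flat c k h\<bar> \<le> C * h\<^sup>2"
          unfolding C_def by (rule flat_le[OF assms])
        then show ?thesis
          using that by (simp add: abs_divide divide_le_eq power2_eq_square mult.assoc)
      qed
      then show "\<forall>\<^sub>F h in at 0. norm (flat c k h / h) \<le> C * \<bar>h\<bar>"
        by (auto simp: eventually_at_filter)
      show "((\<lambda>h. C * \<bar>h\<bar>) \<longlongrightarrow> 0) (at 0)"
        by (auto intro!: tendsto_eq_intros)
    qed
    then show ?thesis
      using 3 by (simp add: DERIV_def flat_def)
  qed
qed

text \<open>
  A family of functions that is closed under differentiation on \<open>x > 0\<close>; its members that vanish
  outside a compact subset of the half-line are test functions.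
\<close>

inductive smooth_pos :: "real \<Rightarrow> (real \<Rightarrow> real) \<Rightarrow> bool" for \<gamma> where
  const: "smooth_pos \<gamma> (\<lambda>x. c)"
| power: "smooth_pos \<gamma> (\<lambda>x. x powr a)"
| expo: "smooth_pos \<gamma> (\<lambda>x. exp (c * x powr \<gamma>))"
| left: "c > 0 \<Longrightarrow> smooth_pos \<gamma> (\<lambda>x. flat c k (x - a))"
| right: "c > 0 \<Longrightarrow> smooth_pos \<gamma> (\<lambda>x. flat c k (a - x))"
| add: "smooth_pos \<gamma> f \<Longrightarrow> smooth_pos \<gamma> g \<Longrightarrow> smooth_pos \<gamma> (\<lambda>x. f x + g x)"
| mult: "smooth_pos \<gamma> f \<Longrightarrow> smooth_pos \<gamma> g \<Longrightarrow> smooth_pos \<gamma> (\<lambda>x. f x * g x)"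

lemma smooth_pos_deriv:
  assumes "smooth_pos \<gamma> f"
  shows "\<exists>f'. smooth_pos \<gamma> f' \<and> (\<forall>x>0. (f has_field_derivative f' x) (at x))"
  using assms
proof induction
  case (const c)
  show ?case
    by (rule exI[of _ "\<lambda>x. 0"]) (auto intro: smooth_pos.const)
next
  case (power a)
  show ?case
    by (rule exI[of _ "\<lambda>x. a * x powr (a - 1)"])
      (auto intro!: smooth_pos.intros has_real_derivative_powr)
next
  case (expo c)
  show ?case
    by (rule exI[of _ "\<lambda>x. exp (c * x powr \<gamma>) * (c * (\<gamma> * x powr (\<gamma> - 1)))"])
      (auto intro!: smooth_pos.intros derivative_eq_intros has_real_derivative_powr)
next
  case (left c k a)
  show ?case
  proof (rule exI[of _ "\<lambda>x. c * flat c (k + 2) (x - a) + (- real k) * flat c (k + 1) (x - a)"],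
      intro conjI allI impI)
    show "smooth_pos \<gamma> (\<lambda>x. c * flat c (k + 2) (x - a) + (- real k) * flat c (k + 1) (x - a))"
      by (intro smooth_pos.intros left)
    show "((\<lambda>x. flat c k (x - a)) has_field_derivative
        c * flat c (k + 2) (x - a) + (- real k) * flat c (k + 1) (x - a)) (at x)" for x
      by (rule DERIV_cong[OF DERIV_chain2[where f = "flat c k" and g = "\<lambda>x. x - a",
              OF flat_has_field_derivative[OF left]]])
        (auto intro!: derivative_eq_intros)
  qed
next
  case (right c k a)
  show ?case
  proof (rule exI[of _ "\<lambda>x. (- c) * flat c (k + 2) (a - x) + real k * flat c (k + 1) (a - x)"],
      intro conjI allI impI)
    show "smooth_pos \<gamma> (\<lambda>x. (- c) * flat c (k + 2) (a - x) + real k * flat c (k + 1) (a - x))"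
      by (intro smooth_pos.intros right)
    show "((\<lambda>x. flat c k (a - x)) has_field_derivative
        (- c) * flat c (k + 2) (a - x) + real k * flat c (k + 1) (a - x)) (at x)" for x
      by (rule DERIV_cong[OF DERIV_chain2[where f = "flat c k" and g = "\<lambda>x. a - x",
              OF flat_has_field_derivative[OF right]]])
        (auto intro!: derivative_eq_intros)
  qed
next
  case (add f g)
  then obtain f' g' where "smooth_pos \<gamma> f'" "\<forall>x>0. (f has_field_derivative f' x) (at x)"
    "smooth_pos \<gamma> g'" "\<forall>x>0. (g has_field_derivative g' x) (at x)"
    by blast
  then show ?case
    by (intro exI[of _ "\<lambda>x. f' x + g' x"]) (auto intro!: smooth_pos.intros derivative_intros)
next
  case (mult f g)
  then obtain f' g' where "smooth_pos \<gamma> f'" "\<forall>x>0. (f has_field_derivative f' x) (at x)"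
    "smooth_pos \<gamma> g'" "\<forall>x>0. (g has_field_derivative g' x) (at x)"
    by blast
  then show ?case
    using mult.hyps
    by (intro exI[of _ "\<lambda>x. f' x * g x + g' x * f x"]) (auto intro!: smooth_pos.intros DERIV_mult)
qed

lemma smooth_pos_continuous_on:
  assumes "smooth_pos \<gamma> f"
  shows "continuous_on {0<..} f"
  using smooth_pos_deriv[OF assms]
  by (auto intro!: continuous_at_imp_continuous_on dest: DERIV_isCont)

text \<open>The sets \<open>x > 0\<close> and \<open>x < a\<close> are open and cover the line
  because \<open>a > 0\<close>. On the first, every iterated derivative agrees with a member of the
  family; on the second, it is 0. This settles differentiability at 0 and on the negative axis,
  where the family itself gives no control.\<close>

lemma smooth_pos_test_function:
  assumes f: "smooth_pos \<gamma> f" and supp: "\<And>x. x \<notin> {a<..<b} \<Longrightarrow> f x = 0" and "0 < a"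
  shows "test_function f"
proof -
  have iter: "\<exists>g. smooth_pos \<gamma> g \<and> (\<forall>x>0. (deriv ^^ k) f x = g x) \<and> (\<forall>x<a. (deriv ^^ k) f x = 0)" for k
  proof (induction k)
    case 0
    show ?case
      by (rule exI[of _ f]) (use f supp in auto)
  next
    case (Suc k)
    then obtain g where g: "smooth_pos \<gamma> g" "\<forall>x>0. (deriv ^^ k) f x = g x" "\<forall>x<a. (deriv ^^ k) f x = 0"
      by blast
    obtain g' where g': "smooth_pos \<gamma> g'" "\<forall>x>0. (g has_field_derivative g' x) (at x)"
      using smooth_pos_deriv[OF g(1)] by blast
    have "((deriv ^^ k) f has_field_derivative g' x) (at x)" if "x > 0" for x
      by (rule has_field_derivative_transform_within_open[where S = "{0<..}" and f = g])
        (use g g' that in auto)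
    moreover have "((deriv ^^ k) f has_field_derivative 0) (at x)" if "x < a" for x
      by (rule has_field_derivative_transform_within_open[where S = "{..<a}" and f = "\<lambda>x. 0"])
        (use g that in auto)
    ultimately show ?case
      using g'(1) by (intro exI[of _ g']) (auto intro!: DERIV_imp_deriv)
  qed
  have diff: "((deriv ^^ k) f) field_differentiable (at x)" for k x
  proof -
    obtain g where g: "smooth_pos \<gamma> g" "\<forall>x>0. (deriv ^^ k) f x = g x" "\<forall>x<a. (deriv ^^ k) f x = 0"
      using iter by blast
    obtain g' where g': "\<forall>x>0. (g has_field_derivative g' x) (at x)"
      using smooth_pos_deriv[OF g(1)] by blast
    show ?thesis
    proof (cases "x > 0")
      case True
      have "((deriv ^^ k) f has_field_derivative g' x) (at x)"
        by (rule has_field_derivative_transform_within_open[where S = "{0<..}" and f = g])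
          (use g g' True in auto)
      then show ?thesis by (auto simp: field_differentiable_def)
    next
      case False
      have "((deriv ^^ k) f has_field_derivative 0) (at x)"
        by (rule has_field_derivative_transform_within_open[where S = "{..<a}" and f = "\<lambda>x. 0"])
          (use g False \<open>0 < a\<close> in auto)
      then show ?thesis by (auto simp: field_differentiable_def)
    qed
  qed
  have sub: "closure {x. f x \<noteq> 0} \<subseteq> {a..b}"
  proof (rule closure_minimal)
    show "{x. f x \<noteq> 0} \<subseteq> {a..b}"
    proof
      fix x assume "x \<in> {x. f x \<noteq> 0}"
      then have "x \<in> {a<..<b}" using supp by blast
      then show "x \<in> {a..b}" by simp
    qed
  qed simp
  then have "compact (closure {x. f x \<noteq> 0})"
    by (meson bounded_closed_interval bounded_subset closed_closure compact_eq_bounded_closed)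
  then show ?thesis
    using diff sub \<open>0 < a\<close> unfolding test_function_def half_line_def by force
qed

subsection \<open>Weak derivatives on the half-line\<close>

abbreviation Leb :: "real measure" where "Leb \<equiv> lebesgue_on half_line"

lemma half_line_lebesgue [simp]: "half_line \<in> sets lebesgue"
  by (simp add: half_line_def)

lemma AE_half_line_negligible:
  assumes "AE x in Leb. P x"
  obtains N where "negligible N" "\<And>x. x > 0 \<Longrightarrow> x \<notin> N \<Longrightarrow> P x"
proof -
  from assms obtain N where "\<And>x. x \<in> space Leb - N \<Longrightarrow> P x" "N \<in> null_sets Leb"
    by (rule AE_E3) auto
  then show ?thesis
    by (intro that[of N]) (auto simp: null_sets_restrict_space negligible_iff_null_sets half_line_def)
qed

lemma AE_half_lineI:
  assumes "\<And>x. x > 0 \<Longrightarrow> P x"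
  shows "AE x in Leb. P x"
  using assms by (auto simp: half_line_def intro!: AE_I2)

lemma AE_not_negligible:
  assumes "negligible N"
  shows "AE x in Leb. x \<notin> N"
proof -
  have "AE x in lebesgue. x \<notin> N"
    using assms by (intro AE_not_in) (simp add: negligible_iff_null_sets)
  then show ?thesis
    by (auto simp: AE_restrict_space_iff elim: eventually_mono)
qed

lemma measurable_Leb_cong_AE:
  fixes f :: "real \<Rightarrow> real"
  assumes "f \<in> borel_measurable Leb" "AE x in Leb. f x = g x"
  shows "g \<in> borel_measurable Leb"
proof -
  have "(\<lambda>x. if x \<in> half_line then f x else 0) \<in> borel_measurable lebesgue"
    using assms(1) by (simp add: borel_measurable_if)
  moreover have "AE x in lebesgue. (if x \<in> half_line then f x else 0) = (if x \<in> half_line then g x else 0)"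
    using assms(2) by (auto simp: AE_restrict_space_iff elim: eventually_mono)
  ultimately have "(\<lambda>x. if x \<in> half_line then g x else 0) \<in> borel_measurable lebesgue"
    by (rule borel_measurable_AE)
  then show ?thesis
    by (simp add: borel_measurable_if)
qed

lemma continuous_on_measurable_Leb:
  fixes f :: "real \<Rightarrow> real"
  assumes "continuous_on {0<..} f"
  shows "f \<in> borel_measurable Leb"
  using assms by (intro continuous_imp_measurable_on_sets_lebesgue) (auto simp: half_line_def)

lemma locally_integrableD:
  assumes "locally_integrable f" "0 < a"
  shows "f absolutely_integrable_on {a..b}"
proof -
  have "compact {a..b}" "{a..b} \<subseteq> half_line"
    using assms(2) by (auto simp: half_line_def)
  then show ?thesis
    using assms(1) by (auto simp: locally_integrable_def)
qed

text \<open>Exhaustion by the compact intervals from \<open>1 / (n + 1)\<close> to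
  \<open>n + 1\<close>. Weak differentiability asserts only local integrability, while dominated
  convergence on the whole half-line asks for measurability.\<close>

lemma locally_integrable_measurable:
  assumes "locally_integrable f"
  shows "f \<in> borel_measurable Leb"
proof -
  define S where "S n = {1 / real (Suc n)..real (Suc n)}" for n
  have meas: "(\<lambda>x. indicator (S n) x *\<^sub>R f x) \<in> borel_measurable lebesgue" for n
    using locally_integrableD[OF assms, of "1 / real (Suc n)" "real (Suc n)"]
    unfolding S_def set_integrable_def by (intro borel_measurable_integrable) auto
  have lim: "(\<lambda>n. indicator (S n) x *\<^sub>R f x) \<longlonglongrightarrow> (if x \<in> half_line then f x else 0)" for x
  proof (rule tendsto_eventually)
    show "\<forall>\<^sub>F n in sequentially. indicator (S n) x *\<^sub>R f x = (if x \<in> half_line then f x else 0)"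
    proof (cases "x > 0")
      case True
      obtain N where N: "max x (1 / x) < real N"
        using reals_Archimedean2 by blast
      have in_S: "x \<in> S n" if "n \<ge> N" for n
      proof -
        have *: "x \<le> real (Suc n)" "1 / x \<le> real (Suc n)"
          using N that by auto
        then have "1 / real (Suc n) \<le> x"
          using True by (simp only: divide_le_eq mult.commute) (simp add: field_simps)
        with * show ?thesis
          by (simp add: S_def)
      qed
      show ?thesis
        using eventually_ge_at_top[of N]
      proof eventually_elim
        case (elim n)
        show ?case
          using in_S[OF elim] True by (simp add: half_line_def)
      qed
    next
      case False
      have "x \<notin> S n" for n
      proof -
        have "0 < 1 / real (Suc n)" by simp
        then show ?thesis
          using False unfolding S_def by (metis atLeastAtMost_iff less_le_trans)
      qed
      then show ?thesis
        using False by (auto simp: half_line_def)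
    qed
  qed
  have "(\<lambda>x. if x \<in> half_line then f x else 0) \<in> borel_measurable lebesgue"
    by (rule borel_measurable_LIMSEQ_real[OF lim meas])
  then show ?thesis
    by (simp add: borel_measurable_if)
qed

lemma locally_integrable_cong_AE:
  assumes f: "locally_integrable f" and ae: "AE x in Leb. f x = g x"
  shows "locally_integrable g"
  unfolding locally_integrable_def
proof (intro allI impI)
  fix K assume K: "compact K \<and> K \<subseteq> half_line"
  obtain N where N: "negligible N" "\<And>x. x > 0 \<Longrightarrow> x \<notin> N \<Longrightarrow> f x = g x"
    using ae by (rule AE_half_line_negligible) blast
  have "f absolutely_integrable_on K"
    using f K by (auto simp: locally_integrable_def)
  then show "g absolutely_integrable_on K"
    by (rule absolutely_integrable_spike[OF _ N(1)]) (use K N(2) in \<open>force simp: half_line_def\<close>)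
qed

lemma locally_integrable_continuous:
  assumes "continuous_on {0<..} f"
  shows "locally_integrable f"
  unfolding locally_integrable_def
proof (intro allI impI)
  fix K assume K: "compact K \<and> K \<subseteq> half_line"
  show "f absolutely_integrable_on K"
  proof (cases "K = {}")
    case False
    obtain a where a: "a \<in> K" "\<forall>x\<in>K. a \<le> x"
      using compact_attains_inf[of K] K False by blast
    obtain b where b: "b \<in> K" "\<forall>x\<in>K. x \<le> b"
      using compact_attains_sup[of K] K False by blast
    have "a > 0"
      using a K by (auto simp: half_line_def)
    then have "f absolutely_integrable_on {a..b}"
      by (intro absolutely_integrable_continuous_real continuous_on_subset[OF assms]) auto
    then show ?thesis
      by (rule set_integrable_subset) (use a b K in \<open>auto intro: lmeasurable_compact fmeasurableD\<close>)
  qed auto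
qed

lemma locally_integrable_times_integrable:
  assumes f: "locally_integrable f" and "0 < a" and h: "continuous_on {a..b} h"
    and supp: "\<And>x. x \<notin> {a..b} \<Longrightarrow> h x = 0"
  shows "integrable Leb (\<lambda>x. f x * h x)"
proof -
  have "(\<lambda>x. h x * f x) absolutely_integrable_on {a..b}"
  proof (rule absolutely_integrable_bounded_measurable_product_real)
    show "h \<in> borel_measurable (lebesgue_on {a..b})"
      using h by (intro continuous_imp_measurable_on_sets_lebesgue) auto
    show "bounded (h ` {a..b})"
      using h by (intro compact_imp_bounded compact_continuous_image) auto
    show "f absolutely_integrable_on {a..b}"
      using f \<open>0 < a\<close> by (rule locally_integrableD)
  qed auto
  moreover have "(\<lambda>x. indicat_real {a..b} x *\<^sub>R (h x * f x)) = (\<lambda>x. indicat_real half_line x *\<^sub>R (f x * h x))"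
    using \<open>0 < a\<close> supp by (auto simp: fun_eq_iff half_line_def indicator_def)
  ultimately show ?thesis
    by (simp only: set_integrable_def integrable_restrict_space half_line_lebesgue Int_absorb2 sets.Int sets.top)
qed

lemma test_function_support:
  assumes "test_function \<phi>"
  obtains a b where "0 < a" "a < b" "\<And>x. x \<notin> {a<..<b} \<Longrightarrow> \<phi> x = 0" "\<And>x. x \<notin> {a<..<b} \<Longrightarrow> deriv \<phi> x = 0"
proof -
  let ?K = "closure {x. \<phi> x \<noteq> 0}"
  have K: "compact ?K" "?K \<subseteq> {0<..}"
    using assms by (auto simp: test_function_def half_line_def)
  obtain a b where ab: "0 < a" "a < b" "?K \<subseteq> {a<..<b}"
  proof (cases "?K = {}")
    case True
    then show ?thesis by (intro that[of 1 2]) auto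
  next
    case False
    obtain a where a: "a \<in> ?K" "\<forall>x\<in>?K. a \<le> x"
      using compact_attains_inf[of ?K] K False by blast
    obtain b where b: "b \<in> ?K" "\<forall>x\<in>?K. x \<le> b"
      using compact_attains_sup[of ?K] K False by blast
    have "a > 0" "a \<le> b" using a b K by auto
    \<comment> \<open>Widening to \<open>a / 2\<close> and \<open>b + 1\<close> puts the support
      into the interior, so that the function and its derivative vanish at both end points.\<close>
    then show ?thesis
      by (intro that[of "a / 2" "b + 1"]) (use a b in \<open>force+\<close>)
  qed
  have out: "\<phi> x = 0 \<and> deriv \<phi> x = 0" if "x \<notin> {a<..<b}" for x
  proof -
    have x: "x \<in> - ?K" using that ab by auto
    have "(\<phi> has_field_derivative 0) (at x)"
      by (rule has_field_derivative_transform_within_open[where S = "- ?K" and f = "\<lambda>x. 0"])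
        (use x closure_subset[of "{x. \<phi> x \<noteq> 0}"] in auto)
    then show ?thesis
      using x closure_subset[of "{x. \<phi> x \<noteq> 0}"] by (auto intro!: DERIV_imp_deriv)
  qed
  show ?thesis
    using that[OF ab(1,2)] out by blast
qed

lemma test_function_derivative:
  assumes "test_function \<phi>"
  shows "(\<phi> has_field_derivative deriv \<phi> x) (at x)"
proof -
  have "((deriv ^^ 0) \<phi>) field_differentiable (at x)"
    using assms unfolding test_function_def by blast
  then show ?thesis
    by (simp add: field_differentiable_derivI)
qed

lemma test_function_continuous:
  assumes "test_function \<phi>"
  shows "continuous_on S \<phi>" "continuous_on S (deriv \<phi>)"
proof -
  have "((deriv ^^ 0) \<phi>) field_differentiable (at x)" "((deriv ^^ 1) \<phi>) field_differentiable (at x)" for x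
    using assms unfolding test_function_def by blast+
  then show "continuous_on S \<phi>" "continuous_on S (deriv \<phi>)"
    by (auto intro!: continuous_at_imp_continuous_on field_differentiable_imp_continuous_at)
qed

lemma locally_integrable_test_integrable:
  assumes "locally_integrable f" "test_function \<phi>"
  shows "integrable Leb (\<lambda>x. f x * \<phi> x)" "integrable Leb (\<lambda>x. f x * deriv \<phi> x)"
proof -
  obtain a b where ab: "0 < a" "a < b" "\<And>x. x \<notin> {a<..<b} \<Longrightarrow> \<phi> x = 0" "\<And>x. x \<notin> {a<..<b} \<Longrightarrow> deriv \<phi> x = 0"
    using assms(2) by (rule test_function_support) blast
  show "integrable Leb (\<lambda>x. f x * \<phi> x)" "integrable Leb (\<lambda>x. f x * deriv \<phi> x)"
    by (rule locally_integrable_times_integrable[OF assms(1) ab(1), of b];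
        use ab(3,4) test_function_continuous[OF assms(2)] in force)+
qed

text \<open>\<open>weak_deriv\<close> returns some representative only, so identities between
  derivatives hold almost everywhere and enter further arguments through this replacement.\<close>

lemma has_weak_deriv_cong_AE:
  assumes fg: "has_weak_deriv f g" and ff: "AE x in Leb. f x = f' x" and gg: "AE x in Leb. g x = g' x"
  shows "has_weak_deriv f' g'"
proof -
  have f: "locally_integrable f" "locally_integrable f'"
    and g: "locally_integrable g" "locally_integrable g'"
    using fg locally_integrable_cong_AE[OF _ ff] locally_integrable_cong_AE[OF _ gg]
    by (auto simp: has_weak_deriv_def)
  note [measurable] = f[THEN locally_integrable_measurable] g[THEN locally_integrable_measurable]
  show ?thesis
    unfolding has_weak_deriv_def
  proof (intro conjI f g allI impI)
    fix \<phi> assume \<phi>: "test_function \<phi>"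
    have [measurable]: "\<phi> \<in> borel_measurable Leb" "deriv \<phi> \<in> borel_measurable Leb"
      using test_function_continuous[OF \<phi>] by (auto intro: continuous_on_measurable_Leb)
    have "(LINT x|Leb. f' x * deriv \<phi> x) = (LINT x|Leb. f x * deriv \<phi> x)"
      using ff by (intro integral_cong_AE) (auto elim: eventually_mono)
    also have "\<dots> = - (LINT x|Leb. g x * \<phi> x)"
      using fg \<phi> by (auto simp: has_weak_deriv_def)
    also have "(LINT x|Leb. g x * \<phi> x) = (LINT x|Leb. g' x * \<phi> x)"
      using gg by (intro integral_cong_AE) (auto elim: eventually_mono)
    finally show "(LINT x|Leb. f' x * deriv \<phi> x) = - (LINT x|Leb. g' x * \<phi> x)" .
  qed
qed

lemma locally_integrable_diff:
  assumes "locally_integrable f" "locally_integrable g"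
  shows "locally_integrable (\<lambda>x. f x - g x)"
  using assms by (auto simp: locally_integrable_def)

lemma has_weak_deriv_diff:
  assumes "has_weak_deriv f g" "has_weak_deriv f' g'"
  shows "has_weak_deriv (\<lambda>x. f x - f' x) (\<lambda>x. g x - g' x)"
  unfolding has_weak_deriv_def
proof (intro conjI locally_integrable_diff allI impI)
  show li: "locally_integrable f" "locally_integrable g" "locally_integrable f'" "locally_integrable g'"
    using assms by (auto simp: has_weak_deriv_def)
  fix \<phi> assume \<phi>: "test_function \<phi>"
  then show "(LINT x|Leb. (f x - f' x) * deriv \<phi> x) = - (LINT x|Leb. (g x - g' x) * \<phi> x)"
    using li[THEN locally_integrable_test_integrable(1), OF \<phi>]
      li[THEN locally_integrable_test_integrable(2), OF \<phi>] assms
    by (simp add: has_weak_deriv_def left_diff_distrib)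
qed

text \<open>The fundamental theorem of calculus for \<open>f * \<phi>\<close> on an interval at
  whose end points \<open>\<phi>\<close> vanishes.\<close>

lemma has_weak_deriv_C1:
  assumes f: "\<And>x. x > 0 \<Longrightarrow> (f has_field_derivative f' x) (at x)" and f': "continuous_on {0<..} f'"
  shows "has_weak_deriv f f'"
  unfolding has_weak_deriv_def
proof (intro conjI allI impI)
  show li: "locally_integrable f" "locally_integrable f'"
    using f f' by (auto intro!: locally_integrable_continuous continuous_at_imp_continuous_on DERIV_isCont)
  fix \<phi> assume \<phi>: "test_function \<phi>"
  obtain a b where ab: "0 < a" "a < b" "\<And>x. x \<notin> {a<..<b} \<Longrightarrow> \<phi> x = 0" "\<And>x. x \<notin> {a<..<b} \<Longrightarrow> deriv \<phi> x = 0"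
    using \<phi> by (rule test_function_support) blast
  let ?h = "\<lambda>x. f x * deriv \<phi> x + f' x * \<phi> x"
  have "((\<lambda>x. f x * \<phi> x) has_vector_derivative ?h x) (at x within {a..b})" if "x \<in> {a..b}" for x
    using DERIV_mult[OF f test_function_derivative[OF \<phi>], of x] that \<open>0 < a\<close>
    by (simp add: has_real_derivative_iff_has_vector_derivative add.commute mult.commute has_vector_derivative_at_within)
  then have "(?h has_integral f b * \<phi> b - f a * \<phi> a) {a..b}"
    using ab(2) by (intro fundamental_theorem_of_calculus) auto
  then have I: "integral {a..b} ?h = 0"
    using ab(3)[of a] ab(3)[of b] by (simp add: has_integral_iff)
  have "continuous_on {a..b} ?h"
    using \<open>0 < a\<close> by (intro continuous_intros test_function_continuous[OF \<phi>] continuous_on_subset[OF f']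
        continuous_at_imp_continuous_on ballI DERIV_isCont[OF f]) auto
  then have "?h absolutely_integrable_on {a..b}"
    by (rule absolutely_integrable_continuous_real)
  then have "set_lebesgue_integral lebesgue {a..b} ?h = 0"
    using I by (simp add: set_lebesgue_integral_eq_integral)
  moreover have "indicat_real {a..b} x *\<^sub>R ?h x = indicat_real half_line x *\<^sub>R ?h x" for x
  proof (cases "x \<in> {a<..<b}")
    case True
    then show ?thesis
      using \<open>0 < a\<close> by (auto simp: half_line_def)
  qed (simp add: ab)
  ultimately have "(LINT x|Leb. ?h x) = 0"
    by (simp only: set_lebesgue_integral_def integral_restrict_space half_line_lebesgue sets.Int sets.top)
  then show "(LINT x|Leb. f x * deriv \<phi> x) = - (LINT x|Leb. f' x * \<phi> x)"
    using li[THEN locally_integrable_test_integrable(1), OF \<phi>]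
      li[THEN locally_integrable_test_integrable(2), OF \<phi>] by simp
qed

section \<open>Uniqueness of weak derivatives\<close>

lemma weierstrass_poly:
  fixes g :: "real \<Rightarrow> real"
  assumes "continuous_on {a..b} g" "0 < e"
  obtains p where "\<And>x. x \<in> {a..b} \<Longrightarrow> \<bar>g x - poly p x\<bar> < e"
proof -
  obtain q where q: "real_polynomial_function q" "\<And>x. x \<in> {a..b} \<Longrightarrow> \<bar>g x - q x\<bar> < e"
    using Stone_Weierstrass_real_polynomial_function[of "{a..b}" g e] assms by auto
  obtain c n where "q = (\<lambda>x. \<Sum>i\<le>n. c i * x ^ i)"
    using q(1) by (auto simp: real_polynomial_function_iff_sum)
  then have "poly (\<Sum>i\<le>n. monom (c i) i) = q"
    by (auto simp: poly_sum poly_monom)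
  then show ?thesis
    using q(2) that by metis
qed

lemma smooth_pos_poly: "smooth_pos \<gamma> (\<lambda>x. poly p (c * x powr a))"
proof (induction p)
  case 0
  show ?case by (simp add: smooth_pos.const)
next
  case (pCons b p)
  then show ?case by (simp add: smooth_pos.intros)
qed

text \<open>The fundamental lemma of the calculus of variations, without mollifiers. On
  \<open>{a<..<b}\<close> a polynomial times the bump \<open>B\<close> is a test function, so
  \<open>h * B\<close> annihilates the polynomials and, by Weierstrass, the continuous functions.
  Continuous functions that tend to \<open>sgn (h x)\<close> almost everywhere then give that the
  integral of \<open>\<bar>h * B\<bar>\<close> is 0, and \<open>B > 0\<close> inside the
  interval.\<close>

lemma test_function_orthogonal_zero:
  assumes h: "locally_integrable h"
    and orth: "\<And>\<phi>. test_function \<phi> \<Longrightarrow> (LINT x|Leb. h x * \<phi> x) = 0"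
  shows "AE x in Leb. h x = 0"
proof -
  have [measurable]: "h \<in> borel_measurable Leb"
    using h by (rule locally_integrable_measurable)
  have local: "AE x in Leb. x \<in> {a<..<b} \<longrightarrow> h x = 0" if "0 < a" for a b
  proof -
    define B where "B x = flat 1 0 (x - a) * flat 1 0 (b - x)" for x
    have B_pos: "B x > 0" if "x \<in> {a<..<b}" for x
      using that by (simp add: B_def flat_def)
    have B_0: "B x = 0" if "x \<notin> {a<..<b}" for x
      using that by (auto simp: B_def flat_def)
    have B_smooth: "smooth_pos 1 B"
      unfolding B_def by (intro smooth_pos.intros) auto
    have B_cont: "continuous_on {0<..} B"
      using B_smooth by (rule smooth_pos_continuous_on)
    have intB: "integrable Leb (\<lambda>x. h x * (g x * B x))" if "continuous_on UNIV g" for g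
      by (rule locally_integrable_times_integrable[OF h \<open>0 < a\<close>, of b])
        (use that B_0 \<open>0 < a\<close> in \<open>force intro!: continuous_intros intro: continuous_on_subset[OF B_cont] continuous_on_subset[of UNIV]\<close>)+
    have poly0: "(LINT x|Leb. h x * (poly p x * B x)) = 0" for p
    proof -
      \<comment> \<open>The form \<open>1 * x powr 1\<close> fits \<open>smooth_pos_poly\<close>. It
        equals \<open>x\<close> for \<open>x > 0\<close>, and elsewhere the factor \<open>B\<close>
        vanishes.\<close>
      have "smooth_pos 1 (\<lambda>x. poly p (1 * x powr 1) * B x)"
        by (intro smooth_pos.mult smooth_pos_poly B_smooth)
      also have "(\<lambda>x. poly p (1 * x powr 1) * B x) = (\<lambda>x. poly p x * B x)"
        using \<open>0 < a\<close> B_0 by (auto simp: fun_eq_iff powr_def intro!: ext) (smt (verit) exp_ln greaterThanLessThan_iff)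
      finally have "test_function (\<lambda>x. poly p x * B x)"
        by (rule smooth_pos_test_function) (use B_0 \<open>0 < a\<close> in auto)
      then show ?thesis
        by (rule orth)
    qed
    have cont0: "(LINT x|Leb. h x * (g x * B x)) = 0" if g: "continuous_on UNIV g" for g
    proof -
      define I where "I = (LINT x|Leb. \<bar>h x * B x\<bar>)"
      have int1: "integrable Leb (\<lambda>x. h x * B x)"
        using intB[of "\<lambda>x. 1"] by simp
      have "\<bar>LINT x|Leb. h x * (g x * B x)\<bar> \<le> e * I" if "e > 0" for e
      proof -
        obtain p where p: "\<And>x. x \<in> {a..b} \<Longrightarrow> \<bar>g x - poly p x\<bar> < e"
          using weierstrass_poly[of a b g e] continuous_on_subset[OF g] \<open>e > 0\<close> by auto
        have intp: "integrable Leb (\<lambda>x. h x * (poly p x * B x))"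
          by (rule intB) (intro continuous_intros)
        have "\<bar>LINT x|Leb. h x * (g x * B x)\<bar> = \<bar>LINT x|Leb. h x * (g x * B x) - h x * (poly p x * B x)\<bar>"
          using poly0[of p] intB[OF g] intp by simp
        also have "\<dots> \<le> (LINT x|Leb. \<bar>h x * (g x * B x) - h x * (poly p x * B x)\<bar>)"
          using integral_norm_bound by (simp flip: real_norm_def)
        also have "\<dots> \<le> (LINT x|Leb. e * \<bar>h x * B x\<bar>)"
        proof (rule integral_mono)
          show "integrable Leb (\<lambda>x. \<bar>h x * (g x * B x) - h x * (poly p x * B x)\<bar>)"
            "integrable Leb (\<lambda>x. e * \<bar>h x * B x\<bar>)"
            using intB[OF g] intp int1 by auto
          fix x
          show "\<bar>h x * (g x * B x) - h x * (poly p x * B x)\<bar> \<le> e * \<bar>h x * B x\<bar>"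
          proof (cases "x \<in> {a<..<b}")
            case True
            have "\<bar>h x * (g x * B x) - h x * (poly p x * B x)\<bar> = \<bar>g x - poly p x\<bar> * \<bar>h x * B x\<bar>"
              by (simp add: abs_mult[symmetric] algebra_simps)
            also have "\<dots> \<le> e * \<bar>h x * B x\<bar>"
              using p[of x] True by (intro mult_right_mono) auto
            finally show ?thesis .
          qed (simp add: B_0)
        qed
        finally show ?thesis
          by (simp add: I_def)
      qed
      then have "((\<lambda>e. e * I) \<longlongrightarrow> 0 * I) (at_right 0) \<Longrightarrow> \<bar>LINT x|Leb. h x * (g x * B x)\<bar> \<le> 0 * I"
        by (intro tendsto_lowerbound[where F = "at_right 0"]) (auto simp: eventually_at_right_less eventually_at_filter)
      moreover have "((\<lambda>e. e * I) \<longlongrightarrow> 0 * I) (at_right 0)"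
        by (intro tendsto_intros)
      ultimately show ?thesis by simp
    qed
    have "(\<lambda>x. sgn (h x)) \<in> borel_measurable Leb"
      by measurable
    then have "(\<lambda>x. sgn (h x)) measurable_on half_line"
      by (simp add: measurable_on_iff_borel_measurable)
    then obtain N g where N: "negligible N" and g: "\<And>n. continuous_on UNIV (g n)"
      and lim: "\<And>x. x \<notin> N \<Longrightarrow> (\<lambda>n. g n x) \<longlonglongrightarrow> (if x \<in> half_line then sgn (h x) else 0)"
      unfolding measurable_on_def by blast
    \<comment> \<open>Clipping to the range of \<open>sgn\<close> keeps the limit and supplies the
      majorant \<open>\<bar>h * B\<bar>\<close>.\<close>
    define c where "c n x = max (- 1) (min 1 (g n x))" for n :: nat and x :: real
    have c: "continuous_on UNIV (c n)" for n
      unfolding c_def by (intro continuous_intros g)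
    have int1: "integrable Leb (\<lambda>x. h x * B x)"
      using intB[of "\<lambda>x. 1"] by simp
    have AE_pos: "AE x in Leb. x > 0"
      by (rule AE_half_lineI)
    have AE_N: "AE x in Leb. x \<notin> N"
      using N by (rule AE_not_negligible)
    have "(\<lambda>n. LINT x|Leb. h x * (c n x * B x)) \<longlonglongrightarrow> (LINT x|Leb. h x * (sgn (h x) * B x))"
    proof (rule integral_dominated_convergence)
      show "integrable Leb (\<lambda>x. \<bar>h x * B x\<bar>)"
        using int1 by auto
      show "(\<lambda>x. h x * (c n x * B x)) \<in> borel_measurable Leb" for n
        using intB[OF c] by auto
      have [measurable]: "B \<in> borel_measurable Leb"
        using B_cont by (rule continuous_on_measurable_Leb)
      show "(\<lambda>x. h x * (sgn (h x) * B x)) \<in> borel_measurable Leb"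
        by measurable
      show "AE x in Leb. (\<lambda>n. h x * (c n x * B x)) \<longlonglongrightarrow> h x * (sgn (h x) * B x)"
        using AE_N AE_pos
      proof eventually_elim
        case (elim x)
        have "(\<lambda>n. g n x) \<longlonglongrightarrow> sgn (h x)"
          using lim[of x] elim by (simp add: half_line_def)
        then have "(\<lambda>n. c n x) \<longlonglongrightarrow> max (- 1) (min 1 (sgn (h x)))"
          unfolding c_def by (intro tendsto_intros)
        then have "(\<lambda>n. c n x) \<longlonglongrightarrow> sgn (h x)"
          by (simp add: sgn_if split: if_splits)
        then show ?case
          by (intro tendsto_intros)
      qed
      show "AE x in Leb. norm (h x * (c n x * B x)) \<le> \<bar>h x * B x\<bar>" for n
      proof (rule AE_I2)
        fix x
        have "\<bar>c n x\<bar> * \<bar>h x * B x\<bar> \<le> 1 * \<bar>h x * B x\<bar>"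
          by (intro mult_right_mono) (auto simp: c_def)
        then show "norm (h x * (c n x * B x)) \<le> \<bar>h x * B x\<bar>"
          by (simp add: abs_mult mult_ac)
      qed
    qed
    then have "(LINT x|Leb. h x * (sgn (h x) * B x)) = 0"
      using cont0[OF c] by (simp add: LIMSEQ_const_iff)
    moreover have B_nonneg: "B x \<ge> 0" for x
      using B_pos[of x] B_0[of x] by force
    have "h x * (sgn (h x) * B x) = \<bar>h x * B x\<bar>" for x
      using B_nonneg[of x] by (simp add: abs_mult abs_sgn[of "h x"])
    ultimately have "(LINT x|Leb. \<bar>h x * B x\<bar>) = 0"
      by simp
    then have "AE x in Leb. \<bar>h x * B x\<bar> = 0"
      using int1 by (subst (asm) integral_nonneg_eq_0_iff_AE) auto
    then show ?thesis
    proof eventually_elim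
      case (elim x)
      then show ?case
        using B_pos[of x] by auto
    qed
  qed
  have "AE x in Leb. \<forall>n. x \<in> {1 / real (Suc n)<..<real (Suc n)} \<longrightarrow> h x = 0"
    by (intro AE_all_countable[THEN iffD2] allI local) simp
  moreover have "AE x in Leb. x > 0"
    by (rule AE_half_lineI)
  ultimately show ?thesis
  proof eventually_elim
    case (elim x)
    obtain n where n: "max x (1 / x) < real n"
      using reals_Archimedean2 by blast
    then have "1 / real (Suc n) < x"
      using elim by (simp add: field_simps)
    then show ?case
      using elim n by (auto dest!: spec[of _ n])
  qed
qed

lemma has_weak_deriv_unique:
  assumes "has_weak_deriv f g" "has_weak_deriv f g'"
  shows "AE x in Leb. g x = g' x"
proof -
  have "has_weak_deriv (\<lambda>x. f x - f x) (\<lambda>x. g x - g' x)"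
    using assms by (rule has_weak_deriv_diff)
  then have "AE x in Leb. g x - g' x = 0"
    by (intro test_function_orthogonal_zero) (auto simp: has_weak_deriv_def)
  then show ?thesis by simp
qed

text \<open>
  The cutoff \<open>exp (- a / (x - a)) * exp (- b / (b - x))\<close> on \<open>{a<..<b}\<close> tends to the constant \<open>exp (- 1)\<close>
  (not 1) as \<open>a \<longlonglongrightarrow> 0\<close> and \<open>b \<longlonglongrightarrow> \<infinity>\<close>, and its derivative times \<open>x\<close> is bounded and tends to 0.
\<close>

lemma weak_integration_by_parts:
  assumes fg: "has_weak_deriv f g" and \<psi>: "smooth_pos \<gamma> \<psi>"
    and \<psi>': "\<And>x. x > 0 \<Longrightarrow> (\<psi> has_field_derivative \<psi>' x) (at x)"
    and int: "integrable Leb (\<lambda>x. f x * \<psi>' x)" "integrable Leb (\<lambda>x. g x * \<psi> x)"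
      "integrable Leb (\<lambda>x. f x * \<psi> x / x)"
  shows "(LINT x|Leb. f x * \<psi>' x) = - (LINT x|Leb. g x * \<psi> x)"
proof -
  define a b where "a n = 1 / real (Suc n)" and "b n = real (Suc n)" for n
  have a: "a n > 0" and b: "b n > 0" for n
    by (auto simp: a_def b_def)
  define cut where "cut n x = flat (a n) 0 (x - a n) * flat (b n) 0 (b n - x)" for n x
  define d where "d n x = a n * flat (a n) 2 (x - a n) * flat (b n) 0 (b n - x)
      - flat (a n) 0 (x - a n) * (b n * flat (b n) 2 (b n - x))" for n x
  have cut_smooth: "smooth_pos \<gamma> (cut n)" for n
    unfolding cut_def by (intro smooth_pos.intros a b)
  have flat_deriv: "(flat c 0 has_field_derivative c * flat c 2 u) (at u)" if "c > 0" for c u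
    using flat_has_field_derivative[OF that, of 0 u] by (simp add: numeral_2_eq_2)
  have cut_deriv: "(cut n has_field_derivative d n x) (at x)" for n x
  proof -
    have "((\<lambda>x. flat (a n) 0 (x - a n)) has_field_derivative a n * flat (a n) 2 (x - a n)) (at x)"
      by (rule DERIV_cong[OF DERIV_chain2[where f = "flat (a n) 0" and g = "\<lambda>x. x - a n",
              OF flat_deriv[OF a]]]) (auto intro!: derivative_eq_intros)
    moreover have "((\<lambda>x. flat (b n) 0 (b n - x)) has_field_derivative - (b n * flat (b n) 2 (b n - x))) (at x)"
      by (rule DERIV_cong[OF DERIV_chain2[where f = "flat (b n) 0" and g = "\<lambda>x. b n - x",
              OF flat_deriv[OF b]]]) (auto intro!: derivative_eq_intros)
    ultimately show ?thesis
      unfolding cut_def d_def by (auto intro!: derivative_eq_intros)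
  qed
  have flat01: "0 \<le> flat c 0 u \<and> flat c 0 u \<le> 1" if "c > 0" for c u
    using that by (auto simp: flat_def)
  have cut_bound: "\<bar>cut n x\<bar> \<le> 1" for n x
    using flat01[OF a[of n], of "x - a n"] flat01[OF b[of n], of "b n - x"]
    by (auto simp: cut_def abs_mult intro!: mult_le_one)
  have exp1: "s * exp (- s) \<le> 1" "s\<^sup>2 * exp (- s) \<le> 2" if "s > 0" for s :: real
  proof -
    have "s \<le> exp s" "s\<^sup>2 \<le> 2 * exp s"
      using exp_ge_add_one_self[of s] exp_lower_Taylor_quadratic[of s] that by linarith+
    then show "s * exp (- s) \<le> 1" "s\<^sup>2 * exp (- s) \<le> 2"
      by (simp_all add: exp_minus field_simps)
  qed
  have d_bound: "\<bar>x * d n x\<bar> \<le> 5" if "x > 0" for n x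
  proof -
    have 1: "0 \<le> x * (a n * flat (a n) 2 (x - a n)) \<and> x * (a n * flat (a n) 2 (x - a n)) \<le> 3"
    proof (cases "x > a n")
      case True
      \<comment> \<open>With \<open>x = u + a n\<close> the product becomes
        \<open>s * exp (- s) + s\<^sup>2 * exp (- s)\<close>, which is at most 1 + 2.\<close>
      define u s where "u = x - a n" and "s = a n / u"
      have "u > 0" "s > 0" using True a[of n] by (auto simp: u_def s_def)
      then have "x * (a n * flat (a n) 2 (x - a n)) = s * exp (- s) + s\<^sup>2 * exp (- s)"
      proof -
        have x: "x = u + a n" by (simp add: u_def)
        have "(u + A) * (A * (E / u\<^sup>2)) = A / u * E + (A / u)\<^sup>2 * E" for A E
          using \<open>u > 0\<close> by (simp add: field_simps power2_eq_square)
        from this[of "a n" "exp (- s)"] show ?thesis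
          using \<open>u > 0\<close> by (simp add: x flat_def s_def)
      qed
      then show ?thesis
        using exp1[OF \<open>s > 0\<close>] \<open>s > 0\<close> by simp
    qed (simp add: flat_def)
    have 2: "0 \<le> x * (b n * flat (b n) 2 (b n - x)) \<and> x * (b n * flat (b n) 2 (b n - x)) \<le> 2"
    proof (cases "x < b n")
      case True
      \<comment> \<open>Here \<open>x < b n\<close>, so \<open>x\<close> may be replaced by
        \<open>b n\<close>, which leaves \<open>s\<^sup>2 * exp (- s)\<close>. Together with the
        bound 3 at the left end this gives the 5 of \<open>d_bound\<close>.\<close>
      define u s where "u = b n - x" and "s = b n / u"
      have u: "u > 0" "s > 0" using True b[of n] by (auto simp: u_def s_def)
      then have nn: "0 \<le> b n * flat (b n) 2 u"
        using b[of n] by (simp add: flat_def)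
      then have "x * (b n * flat (b n) 2 u) \<le> b n * (b n * flat (b n) 2 u)"
        using True by (intro mult_right_mono) auto
      also have "\<dots> = s\<^sup>2 * exp (- s)"
        using u by (simp add: flat_def s_def power2_eq_square)
      finally show ?thesis
        using exp1[OF \<open>s > 0\<close>] nn that by (simp add: u_def)
    qed (simp add: flat_def)
    have "x * d n x = x * (a n * flat (a n) 2 (x - a n)) * flat (b n) 0 (b n - x)
        - flat (a n) 0 (x - a n) * (x * (b n * flat (b n) 2 (b n - x)))"
      by (simp add: d_def algebra_simps)
    moreover have "\<bar>x * (a n * flat (a n) 2 (x - a n)) * flat (b n) 0 (b n - x)\<bar> \<le> 3 * 1"
      unfolding abs_mult[of "x * (a n * flat (a n) 2 (x - a n))"]
      using 1 flat01[OF b[of n], of "b n - x"] by (intro mult_mono) auto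
    moreover have "\<bar>flat (a n) 0 (x - a n) * (x * (b n * flat (b n) 2 (b n - x)))\<bar> \<le> 1 * 2"
      unfolding abs_mult[of "flat (a n) 0 (x - a n)"]
      using 2 flat01[OF a[of n], of "x - a n"] by (intro mult_mono) auto
    ultimately show ?thesis by linarith
  qed
  have ev: "\<forall>\<^sub>F n in sequentially. x - a n > 0 \<and> b n - x > 0" if "x > 0" for x
    unfolding a_def b_def by (intro eventually_conj; use that in real_asymp)
  have lim_a: "(\<lambda>n. flat (a n) 0 (x - a n)) \<longlonglongrightarrow> 1" if "x > 0" for x
  proof (rule Lim_transform_eventually)
    show "(\<lambda>n. exp (- a n / (x - a n))) \<longlonglongrightarrow> 1"
      unfolding a_def using that by real_asymp
    show "\<forall>\<^sub>F n in sequentially. exp (- a n / (x - a n)) = flat (a n) 0 (x - a n)"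
      using ev[OF that] by eventually_elim (simp add: flat_def)
  qed
  have lim_b: "(\<lambda>n. flat (b n) 0 (b n - x)) \<longlonglongrightarrow> exp (- 1)" if "x > 0" for x
  proof (rule Lim_transform_eventually)
    show "(\<lambda>n. exp (- b n / (b n - x))) \<longlonglongrightarrow> exp (- 1)"
      unfolding b_def using that by real_asymp
    show "\<forall>\<^sub>F n in sequentially. exp (- b n / (b n - x)) = flat (b n) 0 (b n - x)"
      using ev[OF that] by eventually_elim (simp add: flat_def)
  qed
  have lim_da: "(\<lambda>n. a n * flat (a n) 2 (x - a n)) \<longlonglongrightarrow> 0" if "x > 0" for x
  proof (rule Lim_transform_eventually)
    show "(\<lambda>n. a n * (exp (- a n / (x - a n)) / (x - a n)\<^sup>2)) \<longlonglongrightarrow> 0"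
      unfolding a_def using that by real_asymp
    show "\<forall>\<^sub>F n in sequentially. a n * (exp (- a n / (x - a n)) / (x - a n)\<^sup>2) = a n * flat (a n) 2 (x - a n)"
      using ev[OF that] by eventually_elim (simp add: flat_def)
  qed
  have lim_db: "(\<lambda>n. b n * flat (b n) 2 (b n - x)) \<longlonglongrightarrow> 0" if "x > 0" for x
  proof (rule Lim_transform_eventually)
    show "(\<lambda>n. b n * (exp (- b n / (b n - x)) / (b n - x)\<^sup>2)) \<longlonglongrightarrow> 0"
      unfolding b_def using that by real_asymp
    show "\<forall>\<^sub>F n in sequentially. b n * (exp (- b n / (b n - x)) / (b n - x)\<^sup>2) = b n * flat (b n) 2 (b n - x)"
      using ev[OF that] by eventually_elim (simp add: flat_def)
  qed
  have lim_cut: "(\<lambda>n. cut n x) \<longlonglongrightarrow> exp (- 1)" if "x > 0" for x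
    using tendsto_mult[OF lim_a[OF that] lim_b[OF that]] by (simp add: cut_def)
  have lim_d: "(\<lambda>n. x * d n x) \<longlonglongrightarrow> 0" if "x > 0" for x
    using tendsto_mult_left[OF tendsto_diff[OF tendsto_mult[OF lim_da[OF that] lim_b[OF that]]
          tendsto_mult[OF lim_a[OF that] lim_db[OF that]]], of x] by (simp add: d_def)
  have [measurable]: "cut n \<in> borel_measurable Leb" for n
    using smooth_pos_continuous_on[OF cut_smooth] by (rule continuous_on_measurable_Leb)
  have "smooth_pos \<gamma> (d n)" for n
  proof -
    have "d n = (\<lambda>x. a n * flat (a n) 2 (x - a n) * flat (b n) 0 (b n - x)
      + (- 1) * (flat (a n) 0 (x - a n) * (b n * flat (b n) 2 (b n - x))))"
      by (simp add: d_def fun_eq_iff)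
    then show ?thesis
      by (simp only:) (intro smooth_pos.intros a b)
  qed
  then have [measurable]: "d n \<in> borel_measurable Leb" for n
    by (intro continuous_on_measurable_Leb smooth_pos_continuous_on)
  have [measurable]: "f \<in> borel_measurable Leb" "g \<in> borel_measurable Leb"
    using fg by (auto simp: has_weak_deriv_def intro: locally_integrable_measurable)
  have [measurable]: "(\<lambda>x::real. x) \<in> borel_measurable Leb"
    by (intro continuous_on_measurable_Leb continuous_intros)
  have [measurable]: "\<psi> \<in> borel_measurable Leb"
    using \<psi> by (intro continuous_on_measurable_Leb smooth_pos_continuous_on)
  have [measurable]: "\<psi>' \<in> borel_measurable Leb"
  proof -
    obtain \<psi>'' where \<psi>'': "smooth_pos \<gamma> \<psi>''" "\<forall>x>0. (\<psi> has_field_derivative \<psi>'' x) (at x)"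
      using smooth_pos_deriv[OF \<psi>] by blast
    have "AE x in Leb. \<psi>'' x = \<psi>' x"
      using \<psi>''(2) \<psi>' by (intro AE_half_lineI) (blast intro: DERIV_unique)
    with continuous_on_measurable_Leb[OF smooth_pos_continuous_on[OF \<psi>''(1)]] show ?thesis
      by (rule measurable_Leb_cong_AE)
  qed
  \<comment> \<open>The term with the derivative of the cutoff is regrouped as
    \<open>f * \<psi> / x\<close>, integrable by assumption, times \<open>x * d n x\<close>, which
    is bounded and tends to 0.\<close>
  have eq: "(LINT x|Leb. f x * \<psi>' x * cut n x + f x * \<psi> x / x * (x * d n x)) = - (LINT x|Leb. g x * \<psi> x * cut n x)" for n
  proof -
    have "test_function (\<lambda>x. \<psi> x * cut n x)"
    proof (rule smooth_pos_test_function)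
      show "smooth_pos \<gamma> (\<lambda>x. \<psi> x * cut n x)"
        by (intro smooth_pos.mult \<psi> cut_smooth)
    qed (use a[of n] in \<open>auto simp: cut_def flat_def\<close>)
    then have "(LINT x|Leb. f x * deriv (\<lambda>x. \<psi> x * cut n x) x) = - (LINT x|Leb. g x * (\<psi> x * cut n x))"
      using fg by (auto simp: has_weak_deriv_def)
    moreover have "(LINT x|Leb. f x * deriv (\<lambda>x. \<psi> x * cut n x) x) =
        (LINT x|Leb. f x * \<psi>' x * cut n x + f x * \<psi> x / x * (x * d n x))"
    proof (rule Bochner_Integration.integral_cong)
      fix x assume "x \<in> space Leb"
      then have "x > 0" by (simp add: half_line_def)
      then have "deriv (\<lambda>x. \<psi> x * cut n x) x = \<psi>' x * cut n x + d n x * \<psi> x"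
        by (intro DERIV_imp_deriv DERIV_mult \<psi>' cut_deriv)
      then show "f x * deriv (\<lambda>x. \<psi> x * cut n x) x = f x * \<psi>' x * cut n x + f x * \<psi> x / x * (x * d n x)"
        using \<open>x > 0\<close> by (simp add: algebra_simps)
    qed simp
    ultimately show ?thesis
      by (simp add: mult.assoc)
  qed
  have "(\<lambda>n. LINT x|Leb. f x * \<psi>' x * cut n x + f x * \<psi> x / x * (x * d n x)) \<longlonglongrightarrow> (LINT x|Leb. f x * \<psi>' x * exp (- 1))"
  proof (rule integral_dominated_convergence)
    show "integrable Leb (\<lambda>x. \<bar>f x * \<psi>' x\<bar> + \<bar>f x * \<psi> x / x\<bar> * 5)"
      by (intro Bochner_Integration.integrable_add integrable_mult_left integrable_abs int)
    show "AE x in Leb. (\<lambda>n. f x * \<psi>' x * cut n x + f x * \<psi> x / x * (x * d n x)) \<longlonglongrightarrow> f x * \<psi>' x * exp (- 1)"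
    proof (rule AE_half_lineI)
      fix x :: real assume "x > 0"
      show "(\<lambda>n. f x * \<psi>' x * cut n x + f x * \<psi> x / x * (x * d n x)) \<longlonglongrightarrow> f x * \<psi>' x * exp (- 1)"
        using tendsto_add[OF tendsto_mult_left[OF lim_cut[OF \<open>x > 0\<close>], of "f x * \<psi>' x"]
            tendsto_mult_left[OF lim_d[OF \<open>x > 0\<close>], of "f x * \<psi> x / x"]] by simp
    qed
    show "AE x in Leb. norm (f x * \<psi>' x * cut n x + f x * \<psi> x / x * (x * d n x)) \<le> \<bar>f x * \<psi>' x\<bar> + \<bar>f x * \<psi> x / x\<bar> * 5" for n
    proof (rule AE_half_lineI)
      fix x :: real assume "x > 0"
      have "\<bar>f x * \<psi>' x\<bar> * \<bar>cut n x\<bar> \<le> \<bar>f x * \<psi>' x\<bar> * 1"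
        by (intro mult_left_mono cut_bound) auto
      moreover have "\<bar>f x * \<psi> x / x\<bar> * \<bar>x * d n x\<bar> \<le> \<bar>f x * \<psi> x / x\<bar> * 5"
        by (intro mult_left_mono d_bound \<open>x > 0\<close>) auto
      ultimately show "norm (f x * \<psi>' x * cut n x + f x * \<psi> x / x * (x * d n x)) \<le> \<bar>f x * \<psi>' x\<bar> + \<bar>f x * \<psi> x / x\<bar> * 5"
        unfolding real_norm_def
        by (intro order_trans[OF abs_triangle_ineq] add_mono) (simp_all only: abs_mult[of "f x * \<psi>' x"] abs_mult[of "f x * \<psi> x / x"])
    qed
  qed measurable
  then have "(\<lambda>n. - (LINT x|Leb. g x * \<psi> x * cut n x)) \<longlonglongrightarrow> (LINT x|Leb. f x * \<psi>' x * exp (- 1))"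
    by (simp only: eq)
  moreover have "(\<lambda>n. LINT x|Leb. g x * \<psi> x * cut n x) \<longlonglongrightarrow> (LINT x|Leb. g x * \<psi> x * exp (- 1))"
  proof (rule integral_dominated_convergence)
    show "integrable Leb (\<lambda>x. \<bar>g x * \<psi> x\<bar>)"
      using int by auto
    show "AE x in Leb. (\<lambda>n. g x * \<psi> x * cut n x) \<longlonglongrightarrow> g x * \<psi> x * exp (- 1)"
      by (rule AE_half_lineI) (intro tendsto_mult_left lim_cut)
    show "AE x in Leb. norm (g x * \<psi> x * cut n x) \<le> \<bar>g x * \<psi> x\<bar>" for n
    proof (rule AE_I2)
      fix x
      have "\<bar>g x * \<psi> x\<bar> * \<bar>cut n x\<bar> \<le> \<bar>g x * \<psi> x\<bar> * 1"
        by (intro mult_left_mono cut_bound) auto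
      then show "norm (g x * \<psi> x * cut n x) \<le> \<bar>g x * \<psi> x\<bar>"
        by (simp add: abs_mult)
    qed
  qed measurable
  ultimately have "(LINT x|Leb. f x * \<psi>' x * exp (- 1)) = - (LINT x|Leb. g x * \<psi> x * exp (- 1))"
    using LIMSEQ_unique tendsto_minus by blast
  \<comment> \<open>The limit \<open>exp (- 1)\<close> of the cutoff appears on both sides and
    cancels.\<close>
  then have "(LINT x|Leb. f x * \<psi>' x) * exp (- 1) = (- (LINT x|Leb. g x * \<psi> x)) * exp (- 1)"
    by simp
  then show ?thesis
    by (subst (asm) mult_right_cancel) auto
qed

subsection \<open>Weighted spaces in the mapped variable\<close>

lemma weighted_L2_D:
  assumes "v \<in> weighted_L2 \<rho>"
  shows "v \<in> borel_measurable Leb" "integrable Leb (\<lambda>x. v x * v x * \<rho> x)"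
  using assms by (auto simp: weighted_L2_def power2_eq_square)

lemma weighted_L2_I:
  assumes "v \<in> borel_measurable Leb" "integrable Leb (\<lambda>x. v x * v x * \<rho> x)"
  shows "v \<in> weighted_L2 \<rho>"
  using assms by (auto simp: weighted_L2_def power2_eq_square)

lemma weighted_L2_bound:
  assumes "w \<in> weighted_L2 \<rho>" "v \<in> borel_measurable Leb" and [measurable]: "\<rho> \<in> borel_measurable Leb"
    and "\<And>x. x > 0 \<Longrightarrow> \<bar>v x\<bar> \<le> \<bar>w x\<bar>" "\<And>x. \<rho> x \<ge> 0"
  shows "v \<in> weighted_L2 \<rho>"
proof (rule weighted_L2_I)
  note [measurable] = assms(2)
  show "integrable Leb (\<lambda>x. v x * v x * \<rho> x)"
  proof (rule Bochner_Integration.integrable_bound[OF weighted_L2_D(2)[OF assms(1)]])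
    show "AE x in Leb. norm (v x * v x * \<rho> x) \<le> norm (w x * w x * \<rho> x)"
    proof (rule AE_half_lineI)
      fix x :: real assume "x > 0"
      have "\<bar>v x\<bar> * \<bar>v x\<bar> * \<rho> x \<le> \<bar>w x\<bar> * \<bar>w x\<bar> * \<rho> x"
        using assms(4)[OF \<open>x > 0\<close>] assms(5) by (intro mult_right_mono mult_mono) auto
      then show "norm (v x * v x * \<rho> x) \<le> norm (w x * w x * \<rho> x)"
        using assms(5)[of x] by (simp add: abs_mult)
    qed
  qed measurable
qed fact

lemma weighted_L2_mult_integrable:
  assumes v: "v \<in> weighted_L2 \<rho>" and w: "w \<in> weighted_L2 \<rho>"
    and \<rho>: "\<rho> \<in> borel_measurable Leb" "\<And>x. \<rho> x \<ge> 0"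
  shows "integrable Leb (\<lambda>x. v x * w x * \<rho> x)"
proof (rule Bochner_Integration.integrable_bound)
  note [measurable] = weighted_L2_D(1)[OF v] weighted_L2_D(1)[OF w] \<rho>(1)
  show "integrable Leb (\<lambda>x. v x * v x * \<rho> x + w x * w x * \<rho> x)"
    using v w by (intro Bochner_Integration.integrable_add weighted_L2_D)
  show "(\<lambda>x. v x * w x * \<rho> x) \<in> borel_measurable Leb"
    by measurable
  have "\<bar>v x * w x\<bar> \<le> v x * v x + w x * w x" for x
  proof -
    have "2 * \<bar>v x * w x\<bar> \<le> v x * v x + w x * w x"
      using sum_squares_bound[of "\<bar>v x\<bar>" "\<bar>w x\<bar>"] by (simp add: abs_mult power2_eq_square)
    then show ?thesis by linarith
  qed
  then have "\<bar>v x * w x\<bar> * \<rho> x \<le> (v x * v x + w x * w x) * \<rho> x" for x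
    using \<rho>(2) by (intro mult_right_mono)
  then show "AE x in Leb. norm (v x * w x * \<rho> x) \<le> norm (v x * v x * \<rho> x + w x * w x * \<rho> x)"
    using \<rho>(2) by (auto simp: abs_mult algebra_simps)
qed

text \<open>The majorant is \<open>x powr (a - 1)\<close> up to 1, where the exponential is at most
  1, and a multiple of \<open>x powr (- 2)\<close> beyond 1, where the exponential is bounded by a
  high negative power of \<open>x powr \<gamma>\<close>.\<close>

lemma integrable_stretched_gamma:
  fixes a c \<gamma> :: real
  assumes "a > 0" "c > 0" "\<gamma> > 0"
  shows "integrable Leb (\<lambda>x. x powr (a - 1) * exp (- c * x powr \<gamma>))"
proof -
  \<comment> \<open>The order \<open>n\<close> is chosen so that
    \<open>a - 1 - \<gamma> * n \<le> - 2\<close>.\<close>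
  obtain n :: nat where "(a + 1) / \<gamma> \<le> real n"
    using real_arch_simple by blast
  then have n: "a + 1 \<le> \<gamma> * real n"
    using \<open>\<gamma> > 0\<close> by (simp add: field_simps)
  define C where "C = fact n / c ^ n"
  have C: "C \<ge> 0" using \<open>c > 0\<close> by (simp add: C_def)
  let ?g = "\<lambda>x. indicat_real {0<..1} x * x powr (a - 1) + C * (indicat_real {1..} x * x powr (- 2))"
  have "(\<lambda>x. x powr (a - 1)) absolutely_integrable_on {0<..1}"
    using assms by (intro nonnegative_absolutely_integrable_1 integrable_on_powr_from_0') auto
  moreover have "(\<lambda>x::real. x powr (- 2)) absolutely_integrable_on {1..}"
    using has_integral_powr_to_inf[of "- 2" 1]
    by (intro nonnegative_absolutely_integrable_1) (auto simp: integrable_on_def)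
  ultimately have "integrable lebesgue ?g"
    unfolding set_integrable_def real_scaleR_def
    by (intro Bochner_Integration.integrable_add integrable_mult_right)
  then have "integrable lebesgue (\<lambda>x. indicat_real half_line x *\<^sub>R ?g x)"
    by (intro integrable_mult_indicator) auto
  then have g: "integrable Leb ?g"
    by (simp add: integrable_restrict_space)
  show ?thesis
  proof (rule Bochner_Integration.integrable_bound[OF g])
    show "(\<lambda>x. x powr (a - 1) * exp (- c * x powr \<gamma>)) \<in> borel_measurable Leb"
      by (intro continuous_on_measurable_Leb continuous_intros) auto
    show "AE x in Leb. norm (x powr (a - 1) * exp (- c * x powr \<gamma>)) \<le> norm (?g x)"
    proof (rule AE_half_lineI)
      fix x :: real assume "x > 0"
      have "x powr (a - 1) * exp (- c * x powr \<gamma>) \<le> ?g x"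
      proof (cases "x \<le> 1")
        case True
        have "x powr (a - 1) * exp (- c * x powr \<gamma>) \<le> x powr (a - 1) * 1"
          using \<open>c > 0\<close> by (intro mult_left_mono) auto
        also have "\<dots> \<le> ?g x"
          using True \<open>x > 0\<close> C by simp
        finally show ?thesis .
      next
        case False
        define z where "z = c * x powr \<gamma>"
        have "z > 0" using assms \<open>x > 0\<close> by (simp add: z_def)
        then have "exp (- z) \<le> fact n / z ^ n"
          by (rule exp_minus_le)
        also have "fact n / z ^ n = C * x powr (- (\<gamma> * real n))"
          using \<open>x > 0\<close> by (simp add: z_def C_def power_mult_distrib powr_minus powr_powr flip: powr_realpow) (simp add: divide_simps)
        finally have "x powr (a - 1) * exp (- z) \<le> x powr (a - 1) * (C * x powr (- (\<gamma> * real n)))"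
          by (intro mult_left_mono) auto
        also have "\<dots> = C * x powr (a - 1 - \<gamma> * real n)"
          by (simp add: powr_diff powr_minus divide_simps)
        also have "\<dots> \<le> C * x powr (- 2)"
          using False n C by (intro mult_left_mono powr_mono) auto
        finally show ?thesis
          using False by (simp add: z_def)
      qed
      then show "norm (x powr (a - 1) * exp (- c * x powr \<gamma>)) \<le> norm (?g x)"
        by (simp only: real_norm_def) (smt (verit) mult_nonneg_nonneg powr_ge_zero exp_ge_zero)
    qed
  qed
qed

locale mapped_weight =
  fixes \<gamma> \<beta> :: real
  assumes gamma_pos: "\<gamma> > 0" and beta_gt: "\<beta> > -1"
begin

definition Y :: "real \<Rightarrow> real" where "Y x = (\<beta> + 1) * x powr \<gamma>"

definition dY :: "real \<Rightarrow> real" where "dY x = \<gamma> * (\<beta> + 1) * x powr (\<gamma> - 1)"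

text \<open>Under \<open>y = Y x\<close>, the measure \<open>W \<alpha> x dx\<close> is the Laguerre
  measure \<open>y powr \<alpha> * exp (- y) dy\<close>. The equal parameters correspond to the case
  without the factor \<open>x powr \<eta>\<close>, to which everything is reduced.\<close>

abbreviation W :: "real \<Rightarrow> real \<Rightarrow> real" where "W \<alpha> \<equiv> weight \<alpha> \<alpha> \<gamma> \<beta>"

abbreviation P :: "real poly \<Rightarrow> real \<Rightarrow> real" where "P p \<equiv> \<lambda>x. poly p (Y x)"

abbreviation L2 :: "real \<Rightarrow> (real \<Rightarrow> real) set" where "L2 \<alpha> \<equiv> weighted_L2 (W \<alpha>)"

abbreviation ip :: "real \<Rightarrow> (real \<Rightarrow> real) \<Rightarrow> (real \<Rightarrow> real) \<Rightarrow> real" where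
  "ip \<alpha> \<equiv> weighted_inner (W \<alpha>)"

abbreviation nsq :: "real \<Rightarrow> (real \<Rightarrow> real) \<Rightarrow> real" where "nsq \<alpha> f \<equiv> ip \<alpha> f f"

lemma Y_nonneg: "Y x \<ge> 0"
  using beta_gt by (simp add: Y_def)

lemma dY_pos: "x > 0 \<Longrightarrow> dY x > 0"
  using beta_gt gamma_pos by (simp add: dY_def)

lemma Y_has_derivative: "x > 0 \<Longrightarrow> (Y has_field_derivative dY x) (at x)"
  unfolding Y_def dY_def by (auto intro!: derivative_eq_intros)

lemma Y_continuous: "continuous_on {0<..} Y"
  unfolding Y_def by (intro continuous_intros) auto

lemma dY_continuous: "continuous_on {0<..} dY"
  unfolding dY_def by (intro continuous_intros) auto

lemma P_continuous: "continuous_on {0<..} (P p)"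
  by (intro continuous_intros Y_continuous)

lemma Y_measurable [measurable]: "Y \<in> borel_measurable Leb"
  by (intro continuous_on_measurable_Leb Y_continuous)

lemma P_measurable [measurable]: "P p \<in> borel_measurable Leb"
  by (intro continuous_on_measurable_Leb P_continuous)

lemma W_measurable [measurable]: "W \<alpha> \<in> borel_measurable Leb"
  unfolding weight_def by (intro continuous_on_measurable_Leb continuous_intros) auto

lemma W_nonneg: "W \<alpha> x \<ge> 0"
  using gamma_pos by (simp add: weight_def)

lemma W_pos: "x > 0 \<Longrightarrow> W \<alpha> x > 0"
  using gamma_pos beta_gt by (simp add: weight_def)

lemmas L2_mult_integrable = weighted_L2_mult_integrable[OF _ _ W_measurable W_nonneg]

lemmas L2_bound = weighted_L2_bound[OF _ _ W_measurable _ W_nonneg]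

lemma L2_diff:
  assumes "f \<in> L2 \<alpha>" "g \<in> L2 \<alpha>"
  shows "(\<lambda>x. f x - g x) \<in> L2 \<alpha>"
proof (rule weighted_L2_I)
  note [measurable] = assms[THEN weighted_L2_D(1)]
  show "(\<lambda>x. f x - g x) \<in> borel_measurable Leb"
    by measurable
  have "integrable Leb (\<lambda>x. f x * f x * W \<alpha> x - 2 * (f x * g x * W \<alpha> x) + g x * g x * W \<alpha> x)"
    using assms by (intro Bochner_Integration.integrable_add Bochner_Integration.integrable_diff integrable_mult_right L2_mult_integrable)
  then show "integrable Leb (\<lambda>x. (f x - g x) * (f x - g x) * W \<alpha> x)"
    by (simp add: algebra_simps)
qed

lemma ip_diff_left:
  assumes "f \<in> L2 \<alpha>" "g \<in> L2 \<alpha>" "h \<in> L2 \<alpha>"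
  shows "ip \<alpha> (\<lambda>x. f x - g x) h = ip \<alpha> f h - ip \<alpha> g h"
  using assms[THEN L2_mult_integrable, OF assms(3)]
  by (simp add: weighted_inner_def left_diff_distrib)

lemma ip_commute: "ip \<alpha> f g = ip \<alpha> g f"
  by (simp add: weighted_inner_def mult_ac)

lemma ip_diff_right:
  assumes "f \<in> L2 \<alpha>" "g \<in> L2 \<alpha>" "h \<in> L2 \<alpha>"
  shows "ip \<alpha> h (\<lambda>x. f x - g x) = ip \<alpha> h f - ip \<alpha> h g"
  using ip_diff_left[OF assms] by (simp add: ip_commute)

lemma nsq_nonneg: "nsq \<alpha> f \<ge> 0"
  using W_nonneg by (simp add: weighted_inner_def)

lemma nsq_diff:
  assumes "f \<in> L2 \<alpha>" "g \<in> L2 \<alpha>"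
  shows "nsq \<alpha> (\<lambda>x. f x - g x) = nsq \<alpha> f - 2 * ip \<alpha> f g + nsq \<alpha> g"
  using assms by (simp add: ip_diff_left ip_diff_right L2_diff ip_commute[of \<alpha> g f])

text \<open>Of the decay \<open>exp (- Y)\<close> of the weight, half is spent and half remains, so
  each monomial gives a convergent stretched gamma integral. The reserve makes
  \<open>exp (Y / 4)\<close> square integrable, as needed to dominate Taylor polynomials of an
  exponential.\<close>

lemma P_exp_integrable:
  assumes "\<alpha> > -1"
  shows "integrable Leb (\<lambda>x. P p x * exp (Y x / 2) * W \<alpha> x)"
proof -
  let ?m = "\<lambda>i x. x powr (\<gamma> * (\<alpha> + 1 + real i) - 1) * exp (- ((\<beta> + 1) / 2) * x powr \<gamma>)"
  have "integrable Leb (\<lambda>x. \<Sum>i\<le>degree p. (coeff p i * \<gamma> * (\<beta> + 1) powr (\<alpha> + 1) * (\<beta> + 1) ^ i) * ?m i x)"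
    using assms beta_gt gamma_pos
    by (intro Bochner_Integration.integrable_sum integrable_mult_right integrable_stretched_gamma) auto
  then show ?thesis
  proof (rule Bochner_Integration.integrable_cong[THEN iffD1, rotated -1])
    fix x assume "x \<in> space Leb"
    then have "x > 0" by (simp add: half_line_def)
    have "x powr (\<gamma> * (\<alpha> + 1 + real i) - 1) = x powr (\<gamma> * (\<alpha> + 1) - 1) * (x powr \<gamma>) ^ i" for i
      using \<open>x > 0\<close> by (simp add: powr_power powr_add[symmetric] algebra_simps)
    moreover have "exp (- ((\<beta> + 1) / 2) * x powr \<gamma>) = exp (Y x / 2) * exp (- (\<beta> + 1) * x powr \<gamma>)"
      by (simp add: Y_def exp_add[symmetric] field_simps)
    ultimately show "(\<Sum>i\<le>degree p. (coeff p i * \<gamma> * (\<beta> + 1) powr (\<alpha> + 1) * (\<beta> + 1) ^ i) * ?m i x)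
        = P p x * exp (Y x / 2) * W \<alpha> x"
      by (simp add: poly_altdef sum_distrib_left sum_distrib_right weight_def Y_def power_mult_distrib mult_ac)
  qed simp
qed

lemma P_exp_L2:
  assumes "\<alpha> > -1"
  shows "(\<lambda>x. P p x * exp (Y x / 4)) \<in> L2 \<alpha>"
proof (rule weighted_L2_I)
  have "exp (Y x / 4) * exp (Y x / 4) = exp (Y x / 2)" for x
    by (simp flip: exp_add)
  moreover have "P p x * exp (Y x / 4) * (P p x * exp (Y x / 4)) = P (p * p) x * (exp (Y x / 4) * exp (Y x / 4))" for x
    by (simp only: poly_mult mult_ac)
  ultimately have "P p x * exp (Y x / 4) * (P p x * exp (Y x / 4)) = P (p * p) x * exp (Y x / 2)" for x
    by (simp only:)
  then show "integrable Leb (\<lambda>x. P p x * exp (Y x / 4) * (P p x * exp (Y x / 4)) * W \<alpha> x)"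
    using P_exp_integrable[OF assms, of "p * p"] by (simp only:)
qed measurable

lemma P_L2:
  assumes "\<alpha> > -1"
  shows "P p \<in> L2 \<alpha>"
proof (rule L2_bound[OF P_exp_L2[OF assms]])
  show "\<bar>P p x\<bar> \<le> \<bar>P p x * exp (Y x / 4)\<bar>" for x
    using mult_left_mono[of 1 "exp (Y x / 4)" "\<bar>P p x\<bar>"] Y_nonneg[of x] by (simp add: abs_mult)
qed measurable

lemma P_has_weak_deriv: "has_weak_deriv (P p) (\<lambda>x. P (pderiv p) x * dY x)"
proof (rule has_weak_deriv_C1)
  show "(P p has_field_derivative P (pderiv p) x * dY x) (at x)" if "x > 0" for x
    by (rule DERIV_chain2[where f = "poly p", OF poly_DERIV Y_has_derivative[OF that]])
  show "continuous_on {0<..} (\<lambda>x. P (pderiv p) x * dY x)"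
    by (intro continuous_on_mult P_continuous dY_continuous)
qed

text \<open>
  With \<open>y = Y x\<close> one has \<open>d/dy (y powr (\<alpha> + 1) * exp (- y) * q y) = y powr \<alpha> * exp (- y) * adj \<alpha> q y\<close>.
\<close>

definition adj :: "real \<Rightarrow> real poly \<Rightarrow> real poly" where
  "adj \<alpha> q = smult (\<alpha> + 1) q - pCons 0 q + pCons 0 (pderiv q)"

text \<open>Integration by parts against \<open>\<psi>\<close>, which is
  \<open>y powr (\<alpha> + 1) * exp (- y) * q y\<close> at \<open>y = Y x\<close>. All three
  integrability conditions reduce to products of square integrable functions, because
  \<open>\<psi>'\<close>, \<open>dY * \<psi>\<close> and \<open>\<psi> / x\<close> are polynomials
  in \<open>Y\<close> times \<open>W \<alpha>\<close>, \<open>W (\<alpha> + 1)\<close> and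
  \<open>W \<alpha> / \<gamma>\<close>.\<close>

lemma ip_deriv:
  assumes \<alpha>: "\<alpha> > -1" and F: "F \<in> L2 \<alpha>" and G: "G \<in> L2 (\<alpha> + 1)"
    and FG: "has_weak_deriv F (\<lambda>x. G x * dY x)"
  shows "ip (\<alpha> + 1) G (P q) = - ip \<alpha> F (P (adj \<alpha> q))"
proof -
  define \<psi> where "\<psi> x = (\<beta> + 1) powr (\<alpha> + 1) * (x powr (\<gamma> * (\<alpha> + 1)) * (exp (- (\<beta> + 1) * x powr \<gamma>) * P q x))" for x
  define \<psi>' where "\<psi>' x = P (adj \<alpha> q) x * W \<alpha> x" for x
  have smooth: "smooth_pos \<gamma> \<psi>"
    unfolding \<psi>_def Y_def by (intro smooth_pos.mult smooth_pos_poly smooth_pos.const smooth_pos.power smooth_pos.expo)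
  have deriv: "(\<psi> has_field_derivative \<psi>' x) (at x)" if "x > 0" for x
  proof -
    have 1: "((\<lambda>x. x powr (\<gamma> * (\<alpha> + 1))) has_field_derivative \<gamma> * (\<alpha> + 1) * x powr (\<gamma> * (\<alpha> + 1) - 1)) (at x)"
      using that by (auto intro!: derivative_eq_intros)
    have 2: "((\<lambda>x. exp (- (\<beta> + 1) * x powr \<gamma>)) has_field_derivative exp (- (\<beta> + 1) * x powr \<gamma>) * (- (\<beta> + 1) * (\<gamma> * x powr (\<gamma> - 1)))) (at x)"
      using that by (auto intro!: derivative_eq_intros)
    have 3: "(P q has_field_derivative P (pderiv q) x * dY x) (at x)"
      by (rule DERIV_chain2[where f = "poly q", OF poly_DERIV Y_has_derivative[OF that]])
    have e1: "x powr (\<gamma> * (\<alpha> + 1)) = x powr (\<gamma> * (\<alpha> + 1) - 1) * x"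
      using that by (simp add: powr_diff)
    have e2: "x * x powr (\<gamma> - 1) = x powr \<gamma>"
      using that by (simp add: powr_diff)
    \<comment> \<open>Apart from the relation between powers of \<open>x\<close> assumed here, the
      derivative formula is a polynomial identity in opaque factors.\<close>
    have alg: "B * ((g * a1 * X1) * (E * Q) + (E * (- b * (g * Z)) * Q + Q' * (g * b * Z) * E) * (X1 * x))
        = (a1 * Q - b * Xg * Q + b * Xg * Q') * (g * B * X1 * E)" if "x * Z = Xg" for B g a1 X1 E Q b Z Q' Xg :: real
      unfolding that[symmetric] by (simp add: algebra_simps)
    have \<psi>'_eq: "\<psi>' x = ((\<alpha> + 1) * P q x - (\<beta> + 1) * x powr \<gamma> * P q x + (\<beta> + 1) * x powr \<gamma> * P (pderiv q) x) *
        (\<gamma> * (\<beta> + 1) powr (\<alpha> + 1) * x powr (\<gamma> * (\<alpha> + 1) - 1) * exp (- (\<beta> + 1) * x powr \<gamma>))"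
      by (simp add: \<psi>'_def adj_def weight_def Y_def)
    show ?thesis
      unfolding \<psi>_def
    proof (rule DERIV_cong[OF DERIV_cmult[OF DERIV_mult[OF 1 DERIV_mult[OF 2 3]]]], unfold e1)
      show "(\<beta> + 1) powr (\<alpha> + 1) * (\<gamma> * (\<alpha> + 1) * x powr (\<gamma> * (\<alpha> + 1) - 1) * (exp (- (\<beta> + 1) * x powr \<gamma>) * P q x) +
         (exp (- (\<beta> + 1) * x powr \<gamma>) * (- (\<beta> + 1) * (\<gamma> * x powr (\<gamma> - 1))) * P q x +
          P (pderiv q) x * dY x * exp (- (\<beta> + 1) * x powr \<gamma>)) * (x powr (\<gamma> * (\<alpha> + 1) - 1) * x)) = \<psi>' x"
        unfolding dY_def \<psi>'_eq by (rule alg[OF e2])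
    qed
  qed
  have e1: "F x * \<psi>' x = F x * P (adj \<alpha> q) x * W \<alpha> x" for x
    by (simp add: \<psi>'_def)
  have e2: "G x * dY x * \<psi> x = G x * P q x * W (\<alpha> + 1) x" if "x > 0" for x
  proof -
    have "x powr (\<gamma> * (\<alpha> + 1 + 1) - 1) = x powr (\<gamma> - 1) * x powr (\<gamma> * (\<alpha> + 1))"
      by (simp add: powr_add[symmetric] algebra_simps)
    moreover have "(\<beta> + 1) powr (\<alpha> + 1 + 1) = (\<beta> + 1) * (\<beta> + 1) powr (\<alpha> + 1)"
      using beta_gt powr_mult_base[of "\<beta> + 1" "\<alpha> + 1"] by (simp add: add_ac)
    ultimately show ?thesis
      by (simp only: \<psi>_def dY_def weight_def mult_ac)
  qed
  have e3: "F x * \<psi> x / x = F x * P q x * W \<alpha> x / \<gamma>" if "x > 0" for x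
    using that gamma_pos by (simp add: \<psi>_def weight_def powr_diff)
  have PL: "P p \<in> L2 \<alpha>" "P p \<in> L2 (\<alpha> + 1)" for p
    using \<alpha> by (auto intro!: P_L2)
  have "(LINT x|Leb. F x * \<psi>' x) = - (LINT x|Leb. (G x * dY x) * \<psi> x)"
  proof (rule weak_integration_by_parts[OF FG smooth deriv])
    show "integrable Leb (\<lambda>x. F x * \<psi>' x)"
      unfolding e1 using F PL by (intro L2_mult_integrable)
    show "integrable Leb (\<lambda>x. G x * dY x * \<psi> x)"
      by (rule Bochner_Integration.integrable_cong[THEN iffD2, OF refl _ L2_mult_integrable[OF G PL(2)[of q]]])
        (auto simp: half_line_def e2)
    show "integrable Leb (\<lambda>x. F x * \<psi> x / x)"
      by (rule Bochner_Integration.integrable_cong[THEN iffD2, OF refl _ integrable_divide[OF L2_mult_integrable[OF F PL(1)[of q]], of \<gamma>]])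
        (auto simp: half_line_def e3)
  qed
  moreover have "(LINT x|Leb. (G x * dY x) * \<psi> x) = (LINT x|Leb. G x * P q x * W (\<alpha> + 1) x)"
    by (rule Bochner_Integration.integral_cong) (auto simp: half_line_def e2)
  ultimately show ?thesis
    by (simp add: weighted_inner_def e1)
qed

end

subsection \<open>Polynomials in the mapped variable\<close>

text \<open>Degree less than \<open>n\<close>, so that \<open>polys 0 = {0}\<close>.\<close>

definition polys :: "nat \<Rightarrow> real poly set" where
  "polys n = {p. \<forall>i\<ge>n. coeff p i = 0}"

lemma polys_0 [simp]: "polys 0 = {0}"
  by (auto simp: polys_def poly_eq_iff)

lemma polys_add: "p \<in> polys n \<Longrightarrow> q \<in> polys n \<Longrightarrow> p + q \<in> polys n"
  by (simp add: polys_def)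

lemma polys_diff: "p \<in> polys n \<Longrightarrow> q \<in> polys n \<Longrightarrow> p - q \<in> polys n"
  by (simp add: polys_def)

lemma polys_smult: "p \<in> polys n \<Longrightarrow> smult c p \<in> polys n"
  by (simp add: polys_def)

lemma polys_mono: "p \<in> polys m \<Longrightarrow> m \<le> n \<Longrightarrow> p \<in> polys n"
  by (simp add: polys_def)

lemma degree_less_polys: "degree p < n \<Longrightarrow> p \<in> polys n"
  by (simp add: polys_def coeff_eq_0)

lemma polys_reduce: "p \<in> polys (Suc n) \<Longrightarrow> coeff Q n = 1 \<Longrightarrow> Q \<in> polys (Suc n) \<Longrightarrow> p - smult (coeff p n) Q \<in> polys n"
  by (auto simp: polys_def Suc_le_eq dest: le_neq_implies_less)

lemma polys_pderiv: "p \<in> polys (Suc n) \<Longrightarrow> pderiv p \<in> polys n"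
  by (simp add: polys_def coeff_pderiv)

context mapped_weight begin

lemma polys_adj: "q \<in> polys n \<Longrightarrow> adj \<alpha> q \<in> polys (Suc n)"
  by (auto simp: polys_def adj_def coeff_pCons coeff_pderiv split: nat.split)

text \<open>\<open>- adj \<alpha> (pderiv q)\<close> is the Laguerre operator \<open>- y q'' - (\<alpha> + 1 - y) q'\<close>.\<close>

lemma polys_laguerre:
  assumes "q \<in> polys (Suc n)"
  shows "- adj \<alpha> (pderiv q) - smult (real n) q \<in> polys n"
proof -
  have "coeff (- adj \<alpha> (pderiv q) - smult (real n) q) i = 0" if "i \<ge> n" for i
    using assms that by (cases i) (auto simp: polys_def adj_def coeff_pCons coeff_pderiv split: nat.split dest: le_neq_implies_less)
  then show ?thesis
    by (simp add: polys_def)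
qed

lemma ip_P_add:
  assumes "\<alpha> > -1" "f \<in> L2 \<alpha>"
  shows "ip \<alpha> f (P (p + q)) = ip \<alpha> f (P p) + ip \<alpha> f (P q)"
  using L2_mult_integrable[OF assms(2) P_L2[OF assms(1)]]
  by (simp add: weighted_inner_def algebra_simps)

lemma ip_P_diff:
  assumes "\<alpha> > -1" "f \<in> L2 \<alpha>"
  shows "ip \<alpha> f (P (p - q)) = ip \<alpha> f (P p) - ip \<alpha> f (P q)"
  using L2_mult_integrable[OF assms(2) P_L2[OF assms(1)]]
  by (simp add: weighted_inner_def algebra_simps)

lemma ip_P_smult: "ip \<alpha> f (P (smult c p)) = c * ip \<alpha> f (P p)"
  by (simp add: weighted_inner_def mult_ac flip: integral_mult_right_zero)

lemma ip_P_uminus: "ip \<alpha> f (P (- p)) = - ip \<alpha> f (P p)"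
  using ip_P_smult[of \<alpha> f "-1" p] by simp

lemma inj_on_Y: "inj_on Y {0<..}"
proof (rule inj_onI)
  fix x y :: real assume *: "x \<in> {0<..}" "y \<in> {0<..}" "Y x = Y y"
  then have "(x powr \<gamma>) powr (1 / \<gamma>) = (y powr \<gamma>) powr (1 / \<gamma>)"
    using beta_gt by (simp add: Y_def)
  then show "x = y"
    using * gamma_pos by (simp add: powr_powr)
qed

text \<open>A nonzero polynomial has finitely many roots and \<open>Y\<close> is injective, so an
  integrand that vanishes almost everywhere would make the interval from 1 to 2 negligible.\<close>

lemma nsq_P_pos:
  assumes "\<alpha> > -1" "p \<noteq> 0"
  shows "nsq \<alpha> (P p) > 0"
proof (rule ccontr)
  assume "\<not> ?thesis"
  then have "(LINT x|Leb. P p x * P p x * W \<alpha> x) = 0"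
    using nsq_nonneg[of \<alpha> "P p"] by (simp add: weighted_inner_def)
  then have "AE x in Leb. P p x * P p x * W \<alpha> x = 0"
    using W_nonneg P_L2[OF assms(1)]
    by (subst (asm) integral_nonneg_eq_0_iff_AE) (auto intro: weighted_L2_D)
  then obtain N where N: "negligible N" "\<And>x. x > 0 \<Longrightarrow> x \<notin> N \<Longrightarrow> P p x * P p x * W \<alpha> x = 0"
    by (rule AE_half_line_negligible) blast
  have "finite (Y -` {y. poly p y = 0} \<inter> {0<..})"
    using poly_roots_finite[OF assms(2)] inj_on_Y by (rule finite_vimage_IntI)
  then have "negligible (N \<union> (Y -` {y. poly p y = 0} \<inter> {0<..}))"
    by (intro negligible_Un[OF N(1)] negligible_finite)
  moreover have "{1..2} \<subseteq> N \<union> (Y -` {y. poly p y = 0} \<inter> {0<..})"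
  proof
    fix x :: real assume "x \<in> {1..2}"
    then have "x > 0" by simp
    then show "x \<in> N \<union> (Y -` {y. poly p y = 0} \<inter> {0<..})"
      using N(2)[of x] W_pos[of x \<alpha>] by (cases "x \<in> N") auto
  qed
  ultimately have "negligible {1..2::real}"
    by (rule negligible_subset)
  then show False
    using negligible_interval(1)[of 1 "2::real"] by simp
qed

text \<open>Gram-Schmidt by induction. The hypothesis is used twice: for \<open>monom 1 n\<close>,
  which yields the monic orthogonal polynomial \<open>Q\<close> of degree \<open>n\<close>, and for
  \<open>F\<close>, whose projection is corrected by a multiple of \<open>Q\<close>.\<close>

lemma poly_proj_exists:
  assumes "\<alpha> > -1" "F \<in> L2 \<alpha>"
  shows "\<exists>p\<in>polys n. \<forall>q\<in>polys n. ip \<alpha> (\<lambda>x. F x - P p x) (P q) = 0"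
  using assms(2)
proof (induction n arbitrary: F)
  case 0
  then show ?case by (simp add: weighted_inner_def)
next
  case (Suc n)
  note PL = P_L2[OF assms(1)]
  obtain r where r: "r \<in> polys n" "\<And>q. q \<in> polys n \<Longrightarrow> ip \<alpha> (\<lambda>x. P (monom 1 n) x - P r x) (P q) = 0"
    using Suc.IH[OF PL[of "monom 1 n"]] by blast
  define Q where "Q = monom 1 n - r"
  have Q: "coeff Q n = 1" "Q \<in> polys (Suc n)"
    using r(1) by (auto simp: Q_def polys_def)
  have Q_orth: "ip \<alpha> (P Q) (P q) = 0" if "q \<in> polys n" for q
    using r(2)[OF that] by (simp add: Q_def)
  have "nsq \<alpha> (P Q) > 0"
    by (rule nsq_P_pos[OF assms(1)]) (use Q(1) in auto)
  obtain p0 where p0: "p0 \<in> polys n" "\<And>q. q \<in> polys n \<Longrightarrow> ip \<alpha> (\<lambda>x. F x - P p0 x) (P q) = 0"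
    using Suc.IH[OF Suc.prems] by blast
  define c where "c = ip \<alpha> F (P Q) / nsq \<alpha> (P Q)"
  define p where "p = p0 + smult c Q"
  have p_ip: "ip \<alpha> (\<lambda>x. F x - P p x) (P q) = ip \<alpha> (\<lambda>x. F x - P p0 x) (P q) - c * ip \<alpha> (P Q) (P q)" for q
  proof -
    have "ip \<alpha> (P q) (P p) = ip \<alpha> (P q) (P p0) + c * ip \<alpha> (P q) (P Q)"
      unfolding p_def by (simp only: ip_P_add[OF assms(1) PL] ip_P_smult)
    then show ?thesis
      using Suc.prems PL by (simp only: ip_diff_left) (simp add: ip_commute[of \<alpha> "P q"])
  qed
  have "ip \<alpha> (\<lambda>x. F x - P p x) (P q) = 0" if q: "q \<in> polys (Suc n)" for q
  proof -
    define q' where "q' = q - smult (coeff q n) Q"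
    have q': "q' \<in> polys n"
      unfolding q'_def using q Q by (intro polys_reduce)
    have FL: "(\<lambda>x. F x - P p x) \<in> L2 \<alpha>"
      using Suc.prems PL by (rule L2_diff)
    have "ip \<alpha> (\<lambda>x. F x - P p x) (P Q) = 0"
      using p_ip[of Q] Suc.prems PL Q_orth[OF p0(1)] \<open>nsq \<alpha> (P Q) > 0\<close>
      by (simp add: ip_diff_left c_def ip_commute[of \<alpha> "P p0"])
    moreover have "ip \<alpha> (\<lambda>x. F x - P p x) (P q') = 0"
      using p_ip[of q'] p0(2)[OF q'] Q_orth[OF q'] by simp
    moreover have "q = smult (coeff q n) Q + q'"
      by (simp add: q'_def)
    ultimately show ?thesis
      using ip_P_add[OF assms(1) FL, of "smult (coeff q n) Q" q'] by (simp add: ip_P_smult del: poly_add poly_smult)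
  qed
  moreover have "p \<in> polys (Suc n)"
    unfolding p_def using p0(1) Q(2) by (intro polys_add polys_smult polys_mono[OF p0(1)]) auto
  ultimately show ?case by blast
qed

lemma nsq_orthogonal_decomp:
  assumes "\<alpha> > -1" "F \<in> L2 \<alpha>" "ip \<alpha> (\<lambda>x. F x - P p x) (P p) = 0"
  shows "nsq \<alpha> F = nsq \<alpha> (\<lambda>x. F x - P p x) + nsq \<alpha> (P p)"
  using assms(3) nsq_diff[OF assms(2) P_L2[OF assms(1)], of p] ip_diff_left[OF assms(2) P_L2 P_L2, OF assms(1) assms(1), of p p]
  by simp

text \<open>The form on derivatives is the inner product with the Laguerre operator applied to
  \<open>q\<close>; both the eigenvalue and the absence of cross terms in the Poincare inequality
  are read off from it.\<close>

lemma ip_pderiv: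
  assumes "\<alpha> > -1"
  shows "ip (\<alpha> + 1) (P (pderiv p)) (P (pderiv q)) = ip \<alpha> (P p) (P (- adj \<alpha> (pderiv q)))"
  unfolding ip_P_uminus by (rule ip_deriv[OF assms P_L2 P_L2 P_has_weak_deriv]) (use assms in auto)

text \<open>Induction on the degree, splitting off the multiple of the monic orthogonal polynomial
  \<open>Q\<close> of degree \<open>K\<close>. Both quadratic forms split without cross term, since
  the Laguerre operator keeps \<open>p'\<close> in degree less than \<open>K\<close>, where
  \<open>Q\<close> is orthogonal. On \<open>Q\<close> the operator acts as multiplication by
  \<open>K\<close> up to lower terms, hence the quotient of the forms is \<open>K\<close>, which is
  at least \<open>N\<close>.\<close>

lemma poly_poincare:
  assumes "\<alpha> > -1"
  shows "p \<in> polys K \<Longrightarrow> (\<And>q. q \<in> polys N \<Longrightarrow> ip \<alpha> (P p) (P q) = 0) \<Longrightarrow>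
    real N * nsq \<alpha> (P p) \<le> nsq (\<alpha> + 1) (P (pderiv p))"
proof (induction K arbitrary: p)
  case 0
  then show ?case by (simp add: weighted_inner_def)
next
  case (Suc K)
  have \<alpha>1: "\<alpha> + 1 > -1" using assms by simp
  note PL = P_L2[OF assms] and PL1 = P_L2[OF \<alpha>1]
  show ?case
  proof (cases "K < N")
    case True
    \<comment> \<open>Here \<open>p\<close> is orthogonal to itself, so its norm is 0.\<close>
    then have "p \<in> polys N"
      by (intro polys_mono[OF Suc.prems(1)]) auto
    then show ?thesis
      using Suc.prems(2) nsq_nonneg by simp
  next
    case False
    obtain r where r: "r \<in> polys K" "\<And>q. q \<in> polys K \<Longrightarrow> ip \<alpha> (\<lambda>x. P (monom 1 K) x - P r x) (P q) = 0"
      using poly_proj_exists[OF assms PL[of "monom 1 K"]] by blast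
    define Q where "Q = monom 1 K - r"
    have Q: "coeff Q K = 1" "Q \<in> polys (Suc K)"
      using r(1) by (auto simp: Q_def polys_def)
    have Q_orth: "ip \<alpha> (P Q) (P q) = 0" if "q \<in> polys K" for q
      using r(2)[OF that] by (simp add: Q_def)
    define c where "c = coeff p K"
    define p' where "p' = p - smult c Q"
    have p': "p' \<in> polys K"
      unfolding p'_def c_def using Suc.prems(1) Q by (intro polys_reduce)
    have p: "p = smult c Q + p'"
      by (simp add: p'_def)
    have exp: "nsq a (P (smult c q1 + q2)) = c\<^sup>2 * nsq a (P q1) + 2 * c * ip a (P q1) (P q2) + nsq a (P q2)"
      if "a > -1" for a q1 q2
    proof -
      let ?f = "P (smult c q1 + q2)"
      have "nsq a ?f = ip a ?f (P (smult c q1)) + ip a ?f (P q2)"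
        by (rule ip_P_add[OF that P_L2[OF that]])
      also have "\<dots> = c * ip a (P q1) ?f + ip a (P q2) ?f"
        by (simp only: ip_P_smult ip_commute[of a ?f])
      also have "\<dots> = c * (c * nsq a (P q1) + ip a (P q1) (P q2)) + (c * ip a (P q2) (P q1) + nsq a (P q2))"
        by (simp only: ip_P_add[OF that P_L2[OF that]] ip_P_smult)
      finally show ?thesis
        by (simp add: ip_commute[of a "P q2" "P q1"] power2_eq_square distrib_left del: poly_add poly_smult)
    qed
    have "ip \<alpha> (P p') (P q) = 0" if "q \<in> polys N" for q
    proof -
      have "q \<in> polys K" using False by (intro polys_mono[OF that]) auto
      have "ip \<alpha> (P q) (P p') = ip \<alpha> (P q) (P p) - c * ip \<alpha> (P q) (P Q)"
        unfolding p'_def by (simp only: ip_P_diff[OF assms PL] ip_P_smult)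
      then show ?thesis
        using Suc.prems(2)[OF that] Q_orth[OF \<open>q \<in> polys K\<close>] by (simp add: ip_commute[of \<alpha> "P q"])
    qed
    then have IH: "real N * nsq \<alpha> (P p') \<le> nsq (\<alpha> + 1) (P (pderiv p'))"
      using Suc.IH[OF p'] by blast
    have n1: "nsq \<alpha> (P p) = c\<^sup>2 * nsq \<alpha> (P Q) + nsq \<alpha> (P p')"
      using exp[OF assms, of Q p'] Q_orth[OF p'] p by simp
    have "- adj \<alpha> (pderiv p') - smult (real K) p' \<in> polys K"
      by (intro polys_laguerre polys_mono[OF p']) simp
    then have "- adj \<alpha> (pderiv p') \<in> polys K"
      using polys_add[OF _ polys_smult[OF p', of "real K"]] by fastforce
    then have "ip (\<alpha> + 1) (P (pderiv Q)) (P (pderiv p')) = 0"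
      unfolding ip_pderiv[OF assms] by (rule Q_orth)
    then have n2: "nsq (\<alpha> + 1) (P (pderiv p)) = c\<^sup>2 * nsq (\<alpha> + 1) (P (pderiv Q)) + nsq (\<alpha> + 1) (P (pderiv p'))"
      using exp[OF \<alpha>1, of "pderiv Q" "pderiv p'"] p by (simp add: pderiv_add pderiv_smult)
    have "ip \<alpha> (P Q) (P (- adj \<alpha> (pderiv Q) - smult (real K) Q)) = 0"
      by (intro Q_orth polys_laguerre Q)
    then have n3: "nsq (\<alpha> + 1) (P (pderiv Q)) = real K * nsq \<alpha> (P Q)"
      by (simp only: ip_pderiv[OF assms] ip_P_diff[OF assms PL] ip_P_smult)
    have "real N * (c\<^sup>2 * nsq \<alpha> (P Q)) \<le> real K * (c\<^sup>2 * nsq \<alpha> (P Q))"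
      using False nsq_nonneg by (intro mult_right_mono) auto
    then show ?thesis
      unfolding n1 n2 n3 using IH by (simp add: algebra_simps)
  qed
qed

end

subsection \<open>Density of polynomials\<close>

context mapped_weight begin

text \<open>The closure in \<open>L2 \<alpha>\<close> of the polynomials in
  \<open>Y\<close>.\<close>

definition approx :: "real \<Rightarrow> (real \<Rightarrow> real) set" where
  "approx \<alpha> = {f \<in> L2 \<alpha>. \<forall>\<epsilon>>0. \<exists>p. nsq \<alpha> (\<lambda>x. f x - P p x) < \<epsilon>}"

lemma nsq_add_le:
  assumes "f \<in> L2 \<alpha>" "g \<in> L2 \<alpha>" "h \<in> L2 \<alpha>" "\<And>x. \<bar>h x\<bar> \<le> \<bar>f x\<bar> + \<bar>g x\<bar>"
  shows "nsq \<alpha> h \<le> 2 * nsq \<alpha> f + 2 * nsq \<alpha> g"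
proof -
  have "(LINT x|Leb. h x * h x * W \<alpha> x) \<le> (LINT x|Leb. 2 * (f x * f x * W \<alpha> x) + 2 * (g x * g x * W \<alpha> x))"
  proof (rule integral_mono)
    fix x
    have "\<bar>h x\<bar> * \<bar>h x\<bar> \<le> (\<bar>f x\<bar> + \<bar>g x\<bar>) * (\<bar>f x\<bar> + \<bar>g x\<bar>)"
      by (intro mult_mono assms) auto
    also have "\<dots> \<le> 2 * (f x * f x) + 2 * (g x * g x)"
      using sum_squares_bound[of "\<bar>f x\<bar>" "\<bar>g x\<bar>"] by (simp add: power2_eq_square algebra_simps)
    finally have "h x * h x * W \<alpha> x \<le> (2 * (f x * f x) + 2 * (g x * g x)) * W \<alpha> x"
      using W_nonneg by (intro mult_right_mono) auto
    then show "h x * h x * W \<alpha> x \<le> 2 * (f x * f x * W \<alpha> x) + 2 * (g x * g x * W \<alpha> x)"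
      by (simp add: algebra_simps)
  qed (use assms(1-3) in \<open>auto intro!: weighted_L2_D\<close>)
  then show ?thesis
    using assms(1,2) by (simp add: weighted_inner_def weighted_L2_D)
qed

lemma L2_add_bound:
  assumes "f \<in> L2 \<alpha>" "g \<in> L2 \<alpha>" "h \<in> borel_measurable Leb" "\<And>x. \<bar>h x\<bar> \<le> \<bar>f x\<bar> + \<bar>g x\<bar>"
  shows "h \<in> L2 \<alpha>"
proof -
  note [measurable] = assms(1,2)[THEN weighted_L2_D(1)]
  have abs: "(\<lambda>x. \<bar>f x\<bar>) \<in> L2 \<alpha>" "(\<lambda>x. - \<bar>g x\<bar>) \<in> L2 \<alpha>"
    by (rule L2_bound[OF assms(1)] L2_bound[OF assms(2)]; simp)+
  show ?thesis
    by (rule L2_bound[OF L2_diff[OF abs]]) (use assms(3,4) in auto)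
qed

lemma approx_limit:
  assumes \<alpha>: "\<alpha> > -1" and f: "f \<in> L2 \<alpha>" and g: "\<And>n. g n \<in> approx \<alpha>"
    and lim: "(\<lambda>n. nsq \<alpha> (\<lambda>x. f x - g n x)) \<longlonglongrightarrow> 0"
  shows "f \<in> approx \<alpha>"
proof -
  have "\<exists>p. nsq \<alpha> (\<lambda>x. f x - P p x) < \<epsilon>" if "\<epsilon> > 0" for \<epsilon>
  proof -
    have "\<forall>\<^sub>F n in sequentially. nsq \<alpha> (\<lambda>x. f x - g n x) < \<epsilon> / 4"
      using lim \<open>\<epsilon> > 0\<close> by (intro order_tendstoD(2)) auto
    then obtain n where n: "nsq \<alpha> (\<lambda>x. f x - g n x) < \<epsilon> / 4"
      by (auto simp: eventually_sequentially)
    obtain p where p: "nsq \<alpha> (\<lambda>x. g n x - P p x) < \<epsilon> / 4"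
      using g[of n] \<open>\<epsilon> > 0\<close> unfolding approx_def by (force dest: spec[of _ "\<epsilon> / 4"])
    have L: "g n \<in> L2 \<alpha>" using g by (simp add: approx_def)
    have "nsq \<alpha> (\<lambda>x. f x - P p x) \<le> 2 * nsq \<alpha> (\<lambda>x. f x - g n x) + 2 * nsq \<alpha> (\<lambda>x. g n x - P p x)"
      by (rule nsq_add_le) (auto intro!: L2_diff f L P_L2 \<alpha>)
    then show ?thesis
      using n p by (intro exI[of _ p]) linarith
  qed
  then show ?thesis
    using f by (simp add: approx_def)
qed

text \<open>The limits in the density argument are pointwise with a square integrable majorant of
  the error, so they are limits in the weighted space by dominated convergence.\<close>

lemma approx_dominated:
  assumes \<alpha>: "\<alpha> > -1" and f: "f \<in> L2 \<alpha>" and g: "\<And>n. g n \<in> approx \<alpha>" and H: "H \<in> L2 \<alpha>"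
    and lim: "AE x in Leb. (\<lambda>n. g n x) \<longlonglongrightarrow> f x"
    and bound: "\<And>n x. x > 0 \<Longrightarrow> \<bar>f x - g n x\<bar> \<le> \<bar>H x\<bar>"
  shows "f \<in> approx \<alpha>"
proof (rule approx_limit[OF \<alpha> f g])
  have gL: "g n \<in> L2 \<alpha>" for n using g by (simp add: approx_def)
  note [measurable] = weighted_L2_D(1)[OF f] weighted_L2_D(1)[OF gL]
  have "(\<lambda>n. LINT x|Leb. (f x - g n x) * (f x - g n x) * W \<alpha> x) \<longlonglongrightarrow> (LINT x|Leb. 0)"
  proof (rule integral_dominated_convergence)
    show "integrable Leb (\<lambda>x. H x * H x * W \<alpha> x)"
      using H by (rule weighted_L2_D)
    show "AE x in Leb. (\<lambda>n. (f x - g n x) * (f x - g n x) * W \<alpha> x) \<longlonglongrightarrow> 0"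
      using lim
    proof eventually_elim
      case (elim x)
      then have "(\<lambda>n. f x - g n x) \<longlonglongrightarrow> f x - f x"
        by (intro tendsto_intros)
      then have "(\<lambda>n. (f x - g n x) * (f x - g n x) * W \<alpha> x) \<longlonglongrightarrow> (f x - f x) * (f x - f x) * W \<alpha> x"
        by (intro tendsto_mult tendsto_const)
      then show ?case by simp
    qed
    show "AE x in Leb. norm ((f x - g n x) * (f x - g n x) * W \<alpha> x) \<le> H x * H x * W \<alpha> x" for n
    proof (rule AE_half_lineI)
      fix x :: real assume "x > 0"
      have "\<bar>f x - g n x\<bar> * \<bar>f x - g n x\<bar> * W \<alpha> x \<le> \<bar>H x\<bar> * \<bar>H x\<bar> * W \<alpha> x"
        using bound[OF \<open>x > 0\<close>, of n] W_nonneg by (intro mult_right_mono mult_mono) auto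
      then show "norm ((f x - g n x) * (f x - g n x) * W \<alpha> x) \<le> H x * H x * W \<alpha> x"
        using W_nonneg[of \<alpha> x] by (simp only: real_norm_def abs_mult abs_of_nonneg abs_mult_self_eq)
    qed
  qed measurable
  then show "(\<lambda>n. nsq \<alpha> (\<lambda>x. f x - g n x)) \<longlonglongrightarrow> 0"
    by (simp add: weighted_inner_def)
qed

lemma approx_P: "\<alpha> > -1 \<Longrightarrow> P p \<in> approx \<alpha>"
  unfolding approx_def using P_L2 by (auto simp: weighted_inner_def intro!: exI[of _ p])

lemma approx_add:
  assumes \<alpha>: "\<alpha> > -1" and f: "f \<in> approx \<alpha>" and g: "g \<in> approx \<alpha>"
  shows "(\<lambda>x. f x + g x) \<in> approx \<alpha>"
proof -
  have L: "f \<in> L2 \<alpha>" "g \<in> L2 \<alpha>" using f g by (simp_all add: approx_def)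
  note [measurable] = L[THEN weighted_L2_D(1)]
  have fg: "(\<lambda>x. f x + g x) \<in> L2 \<alpha>"
    by (rule L2_add_bound[OF L]) auto
  moreover have "\<exists>p. nsq \<alpha> (\<lambda>x. f x + g x - P p x) < \<epsilon>" if "\<epsilon> > 0" for \<epsilon>
  proof -
    obtain p where p: "nsq \<alpha> (\<lambda>x. f x - P p x) < \<epsilon> / 4"
      using f \<open>\<epsilon> > 0\<close> unfolding approx_def by (force dest: spec[of _ "\<epsilon> / 4"])
    obtain q where q: "nsq \<alpha> (\<lambda>x. g x - P q x) < \<epsilon> / 4"
      using g \<open>\<epsilon> > 0\<close> unfolding approx_def by (force dest: spec[of _ "\<epsilon> / 4"])
    have "nsq \<alpha> (\<lambda>x. f x + g x - P (p + q) x) \<le> 2 * nsq \<alpha> (\<lambda>x. f x - P p x) + 2 * nsq \<alpha> (\<lambda>x. g x - P q x)"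
      by (rule nsq_add_le[OF L2_diff L2_diff L2_diff]) (auto intro!: fg L P_L2 \<alpha> simp del: poly_add, auto)
    then show ?thesis
      using p q by (intro exI[of _ "p + q"]) linarith
  qed
  ultimately show ?thesis
    by (simp add: approx_def)
qed

lemma P_mult_L2:
  assumes \<alpha>: "\<alpha> > -1" and [measurable]: "f \<in> borel_measurable Leb" and "\<And>x. x > 0 \<Longrightarrow> \<bar>f x\<bar> \<le> 1"
  shows "(\<lambda>x. P q x * f x) \<in> L2 \<alpha>"
proof (rule L2_bound[OF P_L2[OF \<alpha>, of q]])
  show "\<bar>P q x * f x\<bar> \<le> \<bar>P q x\<bar>" if "x > 0" for x
    using mult_left_mono[OF assms(3)[OF that], of "\<bar>P q x\<bar>"] by (simp add: abs_mult)
qed measurable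

text \<open>
  The Taylor polynomials of \<open>exp (- Y / 4)\<close> are dominated by \<open>exp (Y / 4)\<close>, which is square integrable
  against the weight; higher powers of \<open>exp (- Y / 4)\<close> are approximated one factor at a time.
\<close>

lemma approx_exp:
  assumes \<alpha>: "\<alpha> > -1"
  shows "(\<lambda>x. P q x * exp (- Y x / 4) ^ k) \<in> approx \<alpha>"
proof (induction k arbitrary: q)
  case 0
  then show ?case using approx_P[OF \<alpha>] by simp
next
  case (Suc k)
  define T :: "nat \<Rightarrow> real poly" where "T n = (\<Sum>i<n. monom ((-1 / 4) ^ i / fact i) i)" for n
  have PT: "P (T n) x = (\<Sum>i<n. (- Y x / 4) ^ i / fact i)" for n x
  proof -
    have "(-1 / 4) ^ i / fact i * Y x ^ i = (- Y x / 4) ^ i / fact i" for i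
      by (simp flip: power_mult_distrib)
    then show ?thesis
      by (simp add: T_def poly_sum poly_monom)
  qed
  have sums: "(\<lambda>i. (z::real) ^ i / fact i) sums exp z" for z
    using exp_converges[of z] by (simp add: divide_inverse mult.commute)
  have T_lim: "(\<lambda>n. P (T n) x) \<longlonglongrightarrow> exp (- Y x / 4)" for x
    using sums[of "- Y x / 4"] unfolding sums_def PT .
  have T_bound: "\<bar>P (T n) x\<bar> \<le> exp (Y x / 4)" for n x
  proof -
    have "\<bar>P (T n) x\<bar> \<le> (\<Sum>i<n. \<bar>(- Y x / 4) ^ i / fact i\<bar>)"
      unfolding PT by (rule sum_abs)
    also have "\<dots> = (\<Sum>i<n. (Y x / 4) ^ i / fact i)"
      using Y_nonneg[of x] by (simp add: power_abs abs_divide)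
    also have "\<dots> \<le> exp (Y x / 4)"
      using sums[of "Y x / 4"] Y_nonneg[of x]
      by (auto simp: sums_iff intro!: sum_le_suminf[of _ "{..<n}", THEN order_trans])
    finally show ?thesis .
  qed
  have e1: "\<bar>exp (- Y x / 4) ^ k\<bar> \<le> 1" for x k
    using Y_nonneg[of x] by (auto simp: power_le_one)
  show ?case
  proof (rule approx_dominated[OF \<alpha>])
    show "(\<lambda>x. P q x * exp (- Y x / 4) ^ Suc k) \<in> L2 \<alpha>"
      by (rule P_mult_L2[OF \<alpha>]) (use e1[of _ "Suc k"] in \<open>simp_all del: power_Suc\<close>)
    \<comment> \<open>The Taylor polynomial is absorbed into the polynomial factor, which is why the
      induction runs over arbitrary \<open>q\<close>.\<close>
    show "(\<lambda>x. P (q * T n) x * exp (- Y x / 4) ^ k) \<in> approx \<alpha>" for n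
      by (rule Suc.IH)
    \<comment> \<open>The 2 is one \<open>exp (Y / 4)\<close> for the exponential and one for its
      Taylor polynomial.\<close>
    show "(\<lambda>x. P (smult 2 q) x * exp (Y x / 4)) \<in> L2 \<alpha>"
      by (rule P_exp_L2[OF \<alpha>])
    show "AE x in Leb. (\<lambda>n. P (q * T n) x * exp (- Y x / 4) ^ k) \<longlonglongrightarrow> P q x * exp (- Y x / 4) ^ Suc k"
    proof (rule AE_I2)
      fix x
      have "(\<lambda>n. P q x * P (T n) x * exp (- Y x / 4) ^ k) \<longlonglongrightarrow> P q x * exp (- Y x / 4) * exp (- Y x / 4) ^ k"
        by (intro tendsto_intros T_lim)
      then show "(\<lambda>n. P (q * T n) x * exp (- Y x / 4) ^ k) \<longlonglongrightarrow> P q x * exp (- Y x / 4) ^ Suc k"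
        by (simp add: mult_ac)
    qed
    show "\<bar>P q x * exp (- Y x / 4) ^ Suc k - P (q * T n) x * exp (- Y x / 4) ^ k\<bar> \<le> \<bar>P (smult 2 q) x * exp (Y x / 4)\<bar>" for n x
    proof -
      have "\<bar>exp (- Y x / 4) - P (T n) x\<bar> \<le> 2 * exp (Y x / 4)"
      proof -
        have "exp (- Y x / 4) \<le> exp (Y x / 4)"
          using Y_nonneg[of x] by simp
        then show ?thesis
          using T_bound[of n x] exp_gt_zero[of "- Y x / 4"] by linarith
      qed
      then have "\<bar>P q x\<bar> * \<bar>exp (- Y x / 4) ^ k\<bar> * \<bar>exp (- Y x / 4) - P (T n) x\<bar> \<le> \<bar>P q x\<bar> * 1 * (2 * exp (Y x / 4))"
        using e1[of x k] by (intro mult_mono) auto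
      moreover have "P q x * exp (- Y x / 4) ^ Suc k - P (q * T n) x * exp (- Y x / 4) ^ k = P q x * exp (- Y x / 4) ^ k * (exp (- Y x / 4) - P (T n) x)"
        by (simp add: algebra_simps)
      ultimately show ?thesis
        by (simp only: abs_mult) (simp add: abs_mult mult_ac)
    qed
  qed
qed

lemma approx_poly_exp:
  assumes \<alpha>: "\<alpha> > -1"
  shows "(\<lambda>x. poly p (exp (- Y x / 4))) \<in> approx \<alpha>"
proof -
  have "(\<lambda>x. poly p (exp (- Y x / 4)) * exp (- Y x / 4) ^ k) \<in> approx \<alpha>" for k
  proof (induction p arbitrary: k)
    case 0
    show ?case using approx_P[OF \<alpha>, of 0] by simp
  next
    case (pCons a p)
    show ?case
      using approx_add[OF \<alpha> approx_exp[OF \<alpha>, of "[:a:]" k] pCons.IH[of "Suc k"]]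
      by (simp add: algebra_simps)
  qed
  from this[of 0] show ?thesis by simp
qed

text \<open>The substitution \<open>s = exp (- Y x / 4)\<close> maps the half-line into the unit
  interval, with inverse \<open>X\<close>. The compact support lets \<open>h\<close> composed with
  \<open>X\<close> be continuous up to both ends, so Weierstrass gives polynomials in
  \<open>exp (- Y / 4)\<close> uniformly close to \<open>h\<close> on the whole half-line.\<close>

lemma approx_continuous:
  assumes \<alpha>: "\<alpha> > -1" and "0 < a" "a < b" and h: "continuous_on UNIV h" and h0: "\<And>x. x \<notin> {a<..<b} \<Longrightarrow> h x = 0"
  shows "h \<in> approx \<alpha>"
proof -
  define X where "X s = (- 4 * ln s / (\<beta> + 1)) powr (1 / \<gamma>)" for s
  define S where "S x = exp (- Y x / 4)" for x
  have b1: "\<beta> + 1 > 0" using beta_gt by simp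
  have XS: "X (S x) = x" if "x > 0" for x
    using that b1 gamma_pos by (simp add: X_def S_def Y_def powr_powr)
  have S_less: "S b < S a"
    using assms b1 gamma_pos by (simp add: S_def Y_def powr_less_mono2)
  have S_01: "0 < S x" "S x \<le> 1" for x
    using Y_nonneg[of x] by (auto simp: S_def)
  have S_lt1: "S x < 1" if "x > 0" for x
    using that b1 by (simp add: S_def Y_def)
  have h_low: "h (X s) = 0" if "0 \<le> s" "s \<le> S b" for s
  proof (cases "s = 0")
    \<comment> \<open>Since \<open>ln 0 = 0\<close>, the value \<open>X 0\<close> is 0, where
      \<open>h\<close> vanishes.\<close>
    case True
    then show ?thesis using h0[of 0] \<open>0 < a\<close> by (simp add: X_def)
  next
    case False
    then have "ln s \<le> - Y b / 4"
      using that False S_01[of b] ln_le_cancel_iff[of s "S b"] by (simp add: S_def)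
    then have "b powr \<gamma> \<le> - 4 * ln s / (\<beta> + 1)"
      using b1 by (simp add: Y_def field_simps)
    then have "(b powr \<gamma>) powr (1 / \<gamma>) \<le> X s"
      unfolding X_def using gamma_pos by (intro powr_mono2) auto
    then have "b \<le> X s"
      using assms gamma_pos by (simp add: powr_powr)
    then show ?thesis using h0 by simp
  qed
  have h_high: "h (X s) = 0" if "S a \<le> s" "s \<le> 1" for s
  proof -
    have "s > 0" using that S_01[of a] by linarith
    then have "- Y a / 4 \<le> ln s"
      using that by (simp add: S_def ln_ge_iff)
    then have "- 4 * ln s / (\<beta> + 1) \<le> a powr \<gamma>"
      using b1 by (simp add: Y_def field_simps)
    moreover have "0 \<le> - 4 * ln s / (\<beta> + 1)"
      using \<open>s > 0\<close> that b1 by (simp add: divide_nonpos_pos)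
    ultimately have "X s \<le> (a powr \<gamma>) powr (1 / \<gamma>)"
      unfolding X_def using gamma_pos by (intro powr_mono2) auto
    then have "X s \<le> a"
      using assms gamma_pos by (simp add: powr_powr)
    then show ?thesis using h0 by simp
  qed
  \<comment> \<open>The map \<open>S\<close> is decreasing, so \<open>S b < S a\<close>. On the two
    outer pieces the function is 0, which settles continuity at the ends, where the formula for
    \<open>X\<close> degenerates.\<close>
  have "continuous_on ({0..S b} \<union> ({S b..S a} \<union> {S a..1})) (\<lambda>s. h (X s))"
  proof (intro continuous_on_closed_Un closed_Un closed_atLeastAtMost)
    show "continuous_on {0..S b} (\<lambda>s. h (X s))"
      using h_low by (subst continuous_on_cong[OF refl, of _ _ "\<lambda>s. 0"]) auto
    show "continuous_on {S a..1} (\<lambda>s. h (X s))"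
      using h_high by (subst continuous_on_cong[OF refl, of _ _ "\<lambda>s. 0"]) auto
    have "0 < - 4 * ln s / (\<beta> + 1)" if "s \<in> {S b..S a}" for s
    proof -
      have "0 < s" "s < 1" using that S_01[of b] S_lt1[OF \<open>0 < a\<close>] by auto
      then show ?thesis using b1 by (simp add: divide_neg_pos)
    qed
    moreover have "s > 0" if "s \<in> {S b..S a}" for s
      using that S_01[of b] by auto
    ultimately have "continuous_on {S b..S a} X"
      unfolding X_def using b1 by (intro continuous_intros) fastforce+
    then show "continuous_on {S b..S a} (\<lambda>s. h (X s))"
      by (rule continuous_on_compose2[OF h]) auto
  qed
  moreover have "{0..S b} \<union> ({S b..S a} \<union> {S a..1}) = {0..1}"
    using S_less S_01[of b] S_01[of a] by auto
  ultimately have cont: "continuous_on {0..1} (\<lambda>s. h (X s))"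
    by simp
  have "\<exists>p. \<forall>s\<in>{0..1}. \<bar>h (X s) - poly p s\<bar> < 1 / real (Suc n)" for n
    using weierstrass_poly[OF cont, of "1 / real (Suc n)"] by (metis of_nat_0_less_iff zero_less_Suc zero_less_divide_1_iff)
  then obtain p where p: "\<And>n s. s \<in> {0..1} \<Longrightarrow> \<bar>h (X s) - poly (p n) s\<bar> < 1 / real (Suc n)"
    by metis
  have hp: "\<bar>h x - poly (p n) (S x)\<bar> < 1 / real (Suc n)" if "x > 0" for x n
    using p[of "S x" n] S_01[of x] by (simp add: XS[OF that])
  have [measurable]: "h \<in> borel_measurable Leb"
    by (intro continuous_on_measurable_Leb continuous_on_subset[OF h]) simp
  have "\<exists>B. \<forall>x\<in>{a..b}. \<bar>h x\<bar> \<le> B"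
    using compact_imp_bounded[OF compact_continuous_image[OF continuous_on_subset[OF h subset_UNIV] compact_Icc]]
    by (auto simp: bounded_iff)
  then obtain B where B: "\<And>x. x \<in> {a..b} \<Longrightarrow> \<bar>h x\<bar> \<le> B" by blast
  have hL: "h \<in> L2 \<alpha>"
  proof (rule L2_bound[OF P_L2[OF \<alpha>, of "[:B:]"]])
    show "\<bar>h x\<bar> \<le> \<bar>P [:B:] x\<bar>" for x
      using B[of x] h0[of x] by (cases "x \<in> {a<..<b}") auto
  qed measurable
  show ?thesis
  proof (rule approx_dominated[OF \<alpha> hL])
    show "(\<lambda>x. poly (p n) (S x)) \<in> approx \<alpha>" for n
      unfolding S_def by (rule approx_poly_exp[OF \<alpha>])
    show "P 1 \<in> L2 \<alpha>"
      by (rule P_L2[OF \<alpha>])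
    show "AE x in Leb. (\<lambda>n. poly (p n) (S x)) \<longlonglongrightarrow> h x"
    proof (rule AE_half_lineI)
      fix x :: real assume "x > 0"
      have "(\<lambda>n. h x - poly (p n) (S x)) \<longlonglongrightarrow> 0"
        by (rule Lim_null_comparison[OF always_eventually LIMSEQ_Suc[OF lim_1_over_n]])
          (use hp[OF \<open>x > 0\<close>] in \<open>auto intro: less_imp_le\<close>)
      then show "(\<lambda>n. poly (p n) (S x)) \<longlonglongrightarrow> h x"
        using tendsto_diff[OF tendsto_const[of "h x"]] by fastforce
    qed
    show "\<bar>h x - poly (p n) (S x)\<bar> \<le> \<bar>P 1 x\<bar>" if "x > 0" for n x
    proof -
      have "1 / real (Suc n) \<le> 1" by simp
      then have "\<bar>h x - poly (p n) (S x)\<bar> \<le> 1"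
        using hp[OF that, of n] by linarith
      then show ?thesis by simp
    qed
  qed
qed

end

context mapped_weight begin

text \<open>Continuous functions converge to \<open>F\<close> almost everywhere; clipping them at
  \<open>C\<close> and multiplying by the trapezoid \<open>k\<close>, which is 1 on
  \<open>{a..b}\<close> and 0 outside \<open>{a / 2<..<2 * b}\<close>, keeps the limit and gives
  boundedness and compact support.\<close>

lemma approx_compact_support:
  assumes \<alpha>: "\<alpha> > -1" and ab: "0 < a" "a < b" and F: "F \<in> L2 \<alpha>"
    and C: "\<And>x. \<bar>F x\<bar> \<le> C" and F0: "\<And>x. x \<notin> {a..b} \<Longrightarrow> F x = 0"
  shows "F \<in> approx \<alpha>"
proof -
  have "F measurable_on half_line"
    using weighted_L2_D(1)[OF F] by (simp add: measurable_on_iff_borel_measurable)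
  then obtain N g where N: "negligible N" and g: "\<And>n. continuous_on UNIV (g n)"
    and lim: "\<And>x. x \<notin> N \<Longrightarrow> (\<lambda>n. g n x) \<longlonglongrightarrow> (if x \<in> half_line then F x else 0)"
    unfolding measurable_on_def by blast
  define k where "k x = max 0 (min 1 (min (2 * x / a - 1) (2 - x / b)))" for x :: real
  define h where "h n x = k x * max (- C) (min C (g n x))" for n :: nat and x :: real
  have "C \<ge> 0" using C[of 0] by linarith
  have k0: "k x = 0" if "x \<notin> {a / 2<..<2 * b}" for x
  proof -
    have "2 * x / a - 1 \<le> 0 \<or> 2 - x / b \<le> 0"
      using that ab by (auto simp: field_simps)
    then show ?thesis by (auto simp: k_def)
  qed
  have k1: "k x = 1" if "x \<in> {a..b}" for x
  proof -
    have "2 * x / a - 1 \<ge> 1 \<and> 2 - x / b \<ge> 1"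
      using that ab by (auto simp: field_simps)
    then show ?thesis by (simp add: k_def)
  qed
  have k_bound: "0 \<le> k x" "k x \<le> 1" for x
    by (simp_all add: k_def)
  have kF: "k x * F x = F x" for x
    using k1[of x] F0[of x] by (cases "x \<in> {a..b}") auto
  have h_cont: "continuous_on UNIV (h n)" for n
    unfolding h_def k_def using ab by (intro continuous_intros g) auto
  have h_bound: "\<bar>h n x\<bar> \<le> C" for n x
  proof -
    have "\<bar>k x\<bar> * \<bar>max (- C) (min C (g n x))\<bar> \<le> 1 * C"
      using \<open>C \<ge> 0\<close> k_bound[of x] by (intro mult_mono) auto
    then show ?thesis by (simp add: h_def abs_mult)
  qed
  show ?thesis
  proof (rule approx_dominated[OF \<alpha> F])
    show "h n \<in> approx \<alpha>" for n
      by (rule approx_continuous[OF \<alpha>, of "a / 2" "2 * b"]) (use ab k0 h_cont in \<open>auto simp: h_def\<close>)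
    show "P [:2 * C:] \<in> L2 \<alpha>"
      by (rule P_L2[OF \<alpha>])
    show "\<bar>F x - h n x\<bar> \<le> \<bar>P [:2 * C:] x\<bar>" for n x
      using C[of x] h_bound[of n x] by simp
    have "AE x in Leb. x \<notin> N"
      using N by (rule AE_not_negligible)
    moreover have "AE x in Leb. x > 0"
      by (rule AE_half_lineI)
    ultimately show "AE x in Leb. (\<lambda>n. h n x) \<longlonglongrightarrow> F x"
    proof eventually_elim
      case (elim x)
      then have "(\<lambda>n. g n x) \<longlonglongrightarrow> F x"
        using lim[of x] by (simp add: half_line_def)
      then have "(\<lambda>n. h n x) \<longlonglongrightarrow> k x * max (- C) (min C (F x))"
        unfolding h_def by (intro tendsto_intros)
      moreover have "F x \<le> C" "- C \<le> F x"
        using C[of x] by linarith+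
      then have "max (- C) (min C (F x)) = F x"
        by simp
      ultimately show ?case
        by (simp add: kF)
    qed
  qed
qed

lemma L2_approx:
  assumes \<alpha>: "\<alpha> > -1" and F: "F \<in> L2 \<alpha>"
  shows "F \<in> approx \<alpha>"
proof -
  \<comment> \<open>With \<open>n + 1\<close> in place of \<open>n + 2\<close> the interval would be
    a single point for \<open>n = 0\<close>, while the compactly supported case requires distinct
    end points.\<close>
  define G where "G n x = (if 1 / real (n + 2) \<le> x \<and> x \<le> real (n + 2) \<and> \<bar>F x\<bar> \<le> real n then F x else 0)" for n x
  note [measurable] = weighted_L2_D(1)[OF F]
  have [measurable]: "(\<lambda>x::real. x) \<in> borel_measurable Leb"
    by (intro continuous_on_measurable_Leb continuous_intros)
  have [measurable]: "G n \<in> borel_measurable Leb" for n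
    unfolding G_def by measurable
  have GL: "G n \<in> L2 \<alpha>" for n
    by (rule L2_bound[OF F]) (auto simp: G_def)
  show ?thesis
  proof (rule approx_dominated[OF \<alpha> F _ F])
    show "G n \<in> approx \<alpha>" for n
      by (rule approx_compact_support[OF \<alpha> _ _ GL, of "1 / real (n + 2)" "real (n + 2)" n "real n"])
        (auto simp: G_def field_simps intro!: add_pos_nonneg)
    show "\<bar>F x - G n x\<bar> \<le> \<bar>F x\<bar>" for n x
      by (simp add: G_def)
    show "AE x in Leb. (\<lambda>n. G n x) \<longlonglongrightarrow> F x"
    proof (rule AE_half_lineI)
      fix x :: real assume "x > 0"
      obtain N where N: "max (max x (1 / x)) \<bar>F x\<bar> < real N"
        using reals_Archimedean2 by blast
      have "G n x = F x" if "n \<ge> N" for n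
      proof -
        have *: "x \<le> real (n + 2)" "1 / x \<le> real (n + 2)" "\<bar>F x\<bar> \<le> real n"
          using N that by auto
        then have "1 / real (n + 2) \<le> x"
          using \<open>x > 0\<close> by (simp only: divide_le_eq mult.commute) (simp add: field_simps)
        with * show ?thesis
          by (simp add: G_def)
      qed
      then show "(\<lambda>n. G n x) \<longlonglongrightarrow> F x"
        by (intro tendsto_eventually eventually_sequentiallyI)
    qed
  qed
qed

section \<open>The Poincare inequality and the projection error\<close>

text \<open>Let \<open>r\<close> be the projection of \<open>F\<close> to degree at most
  \<open>K\<close>, with \<open>K \<ge> N\<close>. It inherits the orthogonality of
  \<open>F\<close>, so the polynomial case applies to it. By integration by parts
  \<open>G - r'\<close> is orthogonal to \<open>r'\<close>, whence the norm of \<open>r'\<close> is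
  at most that of \<open>G\<close>. What remains of \<open>F\<close> is as small as desired, by
  density.\<close>

lemma poincare:
  assumes \<alpha>: "\<alpha> > -1" and F: "F \<in> L2 \<alpha>" and G: "G \<in> L2 (\<alpha> + 1)"
    and FG: "has_weak_deriv F (\<lambda>x. G x * dY x)"
    and orth: "\<And>q. q \<in> polys N \<Longrightarrow> ip \<alpha> F (P q) = 0"
  shows "real N * nsq \<alpha> F \<le> nsq (\<alpha> + 1) G"
proof (rule field_le_epsilon)
  fix e :: real assume "e > 0"
  have \<alpha>1: "\<alpha> + 1 > -1" using \<alpha> by simp
  note PL = P_L2[OF \<alpha>] and PL1 = P_L2[OF \<alpha>1]
  \<comment> \<open>The denominator \<open>N + 1\<close> keeps \<open>N\<close> times the error
    below \<open>e\<close> and is positive also for \<open>N = 0\<close>.\<close>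
  obtain p where p: "nsq \<alpha> (\<lambda>x. F x - P p x) < e / (real N + 1)"
    using L2_approx[OF \<alpha> F] \<open>e > 0\<close> unfolding approx_def
    by (force dest: spec[of _ "e / (real N + 1)"])
  define K where "K = max N (degree p)"
  have pK: "p \<in> polys (Suc K)"
    by (rule degree_less_polys) (simp add: K_def)
  obtain r where r: "r \<in> polys (Suc K)" "\<And>q. q \<in> polys (Suc K) \<Longrightarrow> ip \<alpha> (\<lambda>x. F x - P r x) (P q) = 0"
    using poly_proj_exists[OF \<alpha> F] by blast
  have FrL: "(\<lambda>x. F x - P r x) \<in> L2 \<alpha>"
    by (intro L2_diff F PL)
  \<comment> \<open>Pythagoras: the projection \<open>r\<close> is at least as close to
    \<open>F\<close> as the approximant \<open>p\<close> from the density theorem.\<close>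
  have "nsq \<alpha> (\<lambda>x. F x - P r x - P (p - r) x) = nsq \<alpha> (\<lambda>x. F x - P r x) + nsq \<alpha> (P (p - r))"
    using nsq_diff[OF FrL PL, of "p - r"] r(2)[OF polys_diff[OF pK r(1)]] by (simp del: poly_diff)
  then have "nsq \<alpha> (\<lambda>x. F x - P r x) \<le> nsq \<alpha> (\<lambda>x. F x - P p x)"
    using nsq_nonneg[of \<alpha> "P (p - r)"] by simp
  then have small: "real N * nsq \<alpha> (\<lambda>x. F x - P r x) \<le> e"
  proof -
    have "real N * nsq \<alpha> (\<lambda>x. F x - P r x) \<le> real N * (e / (real N + 1))"
      using p \<open>nsq \<alpha> (\<lambda>x. F x - P r x) \<le> _\<close> by (intro mult_left_mono) auto
    also have "\<dots> \<le> e"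
      using \<open>e > 0\<close> by (simp add: field_simps)
    finally show ?thesis .
  qed
  have "ip \<alpha> (P r) (P q) = 0" if "q \<in> polys N" for q
  proof -
    have "q \<in> polys (Suc K)"
      by (rule polys_mono[OF that]) (simp add: K_def)
    then show ?thesis
      using r(2) orth[OF that] ip_diff_left[OF F PL PL, of r q] by simp
  qed
  then have "real N * nsq \<alpha> (P r) \<le> nsq (\<alpha> + 1) (P (pderiv r))"
    by (rule poly_poincare[OF \<alpha> r(1)])
  also have "\<dots> \<le> nsq (\<alpha> + 1) G"
  proof -
    have "has_weak_deriv (\<lambda>x. F x - P r x) (\<lambda>x. G x * dY x - P (pderiv r) x * dY x)"
      by (intro has_weak_deriv_diff FG P_has_weak_deriv)
    then have "has_weak_deriv (\<lambda>x. F x - P r x) (\<lambda>x. (G x - P (pderiv r) x) * dY x)"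
      by (simp add: left_diff_distrib)
    then have "ip (\<alpha> + 1) (\<lambda>x. G x - P (pderiv r) x) (P (pderiv r)) = - ip \<alpha> (\<lambda>x. F x - P r x) (P (adj \<alpha> (pderiv r)))"
      by (intro ip_deriv[OF \<alpha> FrL] L2_diff G PL1)
    also have "\<dots> = 0"
      by (simp add: r(2) polys_adj polys_pderiv r(1))
    finally show ?thesis
      using nsq_orthogonal_decomp[OF \<alpha>1 G] nsq_nonneg[of "\<alpha> + 1"] by simp
  qed
  finally show "real N * nsq \<alpha> F \<le> nsq (\<alpha> + 1) G + e"
    using nsq_orthogonal_decomp[OF \<alpha> F r(2)[OF r(1)]] small by (simp add: algebra_simps)
qed

lemma orthogonal_deriv:
  assumes \<alpha>: "\<alpha> > -1" and F: "F \<in> L2 \<alpha>" and G: "G \<in> L2 (\<alpha> + 1)"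
    and FG: "has_weak_deriv F (\<lambda>x. G x * dY x)"
    and orth: "\<And>q. q \<in> polys (Suc N) \<Longrightarrow> ip \<alpha> F (P q) = 0" and q: "q \<in> polys N"
  shows "ip (\<alpha> + 1) G (P q) = 0"
  using ip_deriv[OF \<alpha> F G FG] orth polys_adj[OF q] by simp

lemma pderiv_iter_polys: "p \<in> polys n \<Longrightarrow> (pderiv ^^ j) p \<in> polys (n - j)"
proof (induction j)
  case (Suc j)
  then show ?case
    \<comment> \<open>The inequality \<open>n - j \<le> Suc (n - Suc j)\<close> also covers
      truncated subtraction.\<close>
    using polys_pderiv[of "(pderiv ^^ j) p" "n - Suc j"] polys_mono[of "(pderiv ^^ j) p" "n - j" "Suc (n - Suc j)"]
    by (simp add: Suc_diff_Suc)
qed simp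

text \<open>\<open>E j\<close> is the \<open>j\<close>-th derivative of the error in the variable
  \<open>y\<close>, and it is orthogonal to \<open>polys (n - j)\<close>. The Poincare factors
  \<open>n - j\<close> telescope to factorials, so the estimate is carried in multiplied form. At
  the end the \<open>m\<close>-th derivative of \<open>p\<close> lies in
  \<open>polys (n - m)\<close>, is therefore orthogonal to \<open>E m\<close>, and drops out by
  Pythagoras.\<close>

lemma projection_error:
  assumes \<theta>: "\<theta> > -1" and F: "\<And>j. j \<le> m \<Longrightarrow> F j \<in> L2 (\<theta> + real j)"
    and chain: "\<And>j. j < m \<Longrightarrow> has_weak_deriv (F j) (\<lambda>x. F (Suc j) x * dY x)"
    and p: "p \<in> polys n" and orth: "\<And>q. q \<in> polys n \<Longrightarrow> ip \<theta> (\<lambda>x. F 0 x - P p x) (P q) = 0"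
    and "m \<le> n" "s \<le> m"
  defines "E \<equiv> \<lambda>j x. F j x - P ((pderiv ^^ j) p) x"
  shows "fact (n - s) * nsq (\<theta> + real s) (E s) \<le> fact (n - m) * nsq (\<theta> + real m) (F m)"
proof -
  have \<theta>j: "\<theta> + real j > -1" for j using \<theta> by simp
  note PL = P_L2[OF \<theta>j]
  have E: "E j \<in> L2 (\<theta> + real j)" if "j \<le> m" for j
    unfolding E_def using F[OF that] PL by (rule L2_diff)
  have E': "E (Suc j) \<in> L2 (\<theta> + real j + 1)" if "Suc j \<le> m" for j
    using E[OF that] by (simp add: add_ac)
  have wd: "has_weak_deriv (E j) (\<lambda>x. E (Suc j) x * dY x)" if "j < m" for j
    using has_weak_deriv_diff[OF chain[OF that] P_has_weak_deriv[of "(pderiv ^^ j) p"]]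
    by (simp add: E_def left_diff_distrib)
  have orthE: "ip (\<theta> + real j) (E j) (P q) = 0" if "j \<le> m" "q \<in> polys (n - j)" for j q
    using that
  proof (induction j arbitrary: q)
    case 0
    then show ?case using orth by (simp add: E_def)
  next
    case (Suc j)
    have "ip (\<theta> + real j + 1) (E (Suc j)) (P q) = 0"
    proof (rule orthogonal_deriv[OF \<theta>j E E' wd])
      show "ip (\<theta> + real j) (E j) (P q) = 0" if "q \<in> polys (Suc (n - Suc j))" for q
        using Suc.IH[of q] Suc.prems that \<open>m \<le> n\<close> by (simp add: Suc_diff_Suc)
    qed (use Suc.prems in auto)
    then show ?case by (simp add: add_ac)
  qed
  have "fact (n - s) * nsq (\<theta> + real s) (E s) \<le> fact (n - j) * nsq (\<theta> + real j) (E j)" if "s \<le> j" "j \<le> m" for j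
    using that
  proof (induction j rule: dec_induct)
    case (step j)
    have "real (n - j) * nsq (\<theta> + real j) (E j) \<le> nsq (\<theta> + real j + 1) (E (Suc j))"
      using step.prems step.hyps by (intro poincare[OF \<theta>j E E' wd] orthE) auto
    then have "fact (n - Suc j) * (real (n - j) * nsq (\<theta> + real j) (E j)) \<le> fact (n - Suc j) * nsq (\<theta> + real (Suc j)) (E (Suc j))"
      by (intro mult_left_mono) (auto simp: add_ac)
    moreover have "fact (n - j) = fact (n - Suc j) * real (n - j)"
    proof -
      have "n - j = Suc (n - Suc j)" using step \<open>m \<le> n\<close> by simp
      then show ?thesis by (simp only: fact_Suc mult.commute)
    qed
    ultimately have "fact (n - j) * nsq (\<theta> + real j) (E j) \<le> fact (n - Suc j) * nsq (\<theta> + real (Suc j)) (E (Suc j))"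
      by (simp only: mult.assoc)
    moreover have "fact (n - s) * nsq (\<theta> + real s) (E s) \<le> fact (n - j) * nsq (\<theta> + real j) (E j)"
      using step by simp
    ultimately show ?case
      by linarith
  qed simp
  from this[OF \<open>s \<le> m\<close> order_refl] have *: "fact (n - s) * nsq (\<theta> + real s) (E s) \<le> fact (n - m) * nsq (\<theta> + real m) (E m)" .
  have "nsq (\<theta> + real m) (F m) = nsq (\<theta> + real m) (E m) + nsq (\<theta> + real m) (P ((pderiv ^^ m) p))"
    unfolding E_def
    by (rule nsq_orthogonal_decomp[OF \<theta>j F[OF order_refl] orthE[OF order_refl pderiv_iter_polys[OF p], unfolded E_def]])
  then have "nsq (\<theta> + real m) (E m) \<le> nsq (\<theta> + real m) (F m)"
    using nsq_nonneg[of "\<theta> + real m" "P ((pderiv ^^ m) p)"] by simp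
  then have "fact (n - m) * nsq (\<theta> + real m) (E m) \<le> fact (n - m) * nsq (\<theta> + real m) (F m)"
    by (intro mult_left_mono) auto
  with * show ?thesis by linarith
qed

end

subsection \<open>Transfer to the scaled mapped derivative\<close>

lemma weighted_L2_cong_AE:
  assumes v: "v \<in> weighted_L2 \<rho>" and [measurable]: "\<rho> \<in> borel_measurable Leb" and ae: "AE x in Leb. v x = w x"
  shows "w \<in> weighted_L2 \<rho>" "weighted_inner \<rho> w w = weighted_inner \<rho> v v"
proof -
  note [measurable] = weighted_L2_D(1)[OF v]
  have [measurable]: "w \<in> borel_measurable Leb"
    using weighted_L2_D(1)[OF v] ae by (rule measurable_Leb_cong_AE)
  have eq: "AE x in Leb. v x * v x * \<rho> x = w x * w x * \<rho> x"
    using ae by eventually_elim simp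
  have "integrable Leb (\<lambda>x. w x * w x * \<rho> x)"
    by (rule integrable_cong_AE_imp[OF weighted_L2_D(2)[OF v] _ eq]) measurable
  then show "w \<in> weighted_L2 \<rho>"
    by (intro weighted_L2_I) auto
  show "weighted_inner \<rho> w w = weighted_inner \<rho> v v"
    unfolding weighted_inner_def
    by (rule integral_cong_AE) (use eq in \<open>auto elim: eventually_mono\<close>)
qed

context mapped_weight begin

text \<open>The two factors \<open>x powr (- \<eta>)\<close> contribute exactly
  \<open>- \<gamma> * (\<theta> - \<sigma>)\<close> to the exponent, which trades \<sigma> for
  \<theta> in the weight.\<close>

lemma weight_scaled:
  assumes "x > 0"
  shows "v * w * weight (\<theta> + r) (\<sigma> + r) \<gamma> \<beta> x =
    (x powr (- (\<gamma> * (\<theta> - \<sigma>) / 2)) * v) * (x powr (- (\<gamma> * (\<theta> - \<sigma>) / 2)) * w) * W (\<theta> + r) x"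
proof -
  have "x powr (\<gamma> * (\<sigma> + r + 1) - 1) =
      x powr (- (\<gamma> * (\<theta> - \<sigma>) / 2)) * x powr (- (\<gamma> * (\<theta> - \<sigma>) / 2)) * x powr (\<gamma> * (\<theta> + r + 1) - 1)"
    by (simp add: powr_add[symmetric] algebra_simps)
  then show ?thesis
    by (simp add: weight_def mult_ac)
qed

lemma scaled_L2_iff:
  "v \<in> weighted_L2 (weight (\<theta> + r) (\<sigma> + r) \<gamma> \<beta>) \<longleftrightarrow> (\<lambda>x. x powr (- (\<gamma> * (\<theta> - \<sigma>) / 2)) * v x) \<in> L2 (\<theta> + r)"
proof -
  let ?\<eta> = "\<gamma> * (\<theta> - \<sigma>) / 2"
  have pm: "(\<lambda>x. x powr a) \<in> borel_measurable Leb" for a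
    by (intro continuous_on_measurable_Leb continuous_intros) auto
  have "v \<in> borel_measurable Leb \<longleftrightarrow> (\<lambda>x. x powr (- ?\<eta>) * v x) \<in> borel_measurable Leb"
  proof
    assume "(\<lambda>x. x powr (- ?\<eta>) * v x) \<in> borel_measurable Leb"
    with pm have "(\<lambda>x. x powr ?\<eta> * (x powr (- ?\<eta>) * v x)) \<in> borel_measurable Leb"
      by (rule borel_measurable_times)
    then show "v \<in> borel_measurable Leb"
      by (rule measurable_Leb_cong_AE) (auto intro!: AE_half_lineI simp: powr_minus)
  qed (intro borel_measurable_times pm; assumption)
  moreover have "integrable Leb (\<lambda>x. \<bar>v x\<bar>\<^sup>2 * weight (\<theta> + r) (\<sigma> + r) \<gamma> \<beta> x) \<longleftrightarrow>
      integrable Leb (\<lambda>x. \<bar>x powr (- ?\<eta>) * v x\<bar>\<^sup>2 * W (\<theta> + r) x)"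
    by (rule Bochner_Integration.integrable_cong)
      (simp_all add: half_line_def power2_eq_square weight_scaled[of _ "v _" "v _"])
  ultimately show ?thesis
    by (simp add: weighted_L2_def)
qed

lemma scaled_inner:
  "weighted_inner (weight (\<theta> + r) (\<sigma> + r) \<gamma> \<beta>) v w =
    ip (\<theta> + r) (\<lambda>x. x powr (- (\<gamma> * (\<theta> - \<sigma>) / 2)) * v x) (\<lambda>x. x powr (- (\<gamma> * (\<theta> - \<sigma>) / 2)) * w x)"
  unfolding weighted_inner_def
  by (rule Bochner_Integration.integral_cong) (simp_all add: half_line_def weight_scaled[of _ "v _" "w _"])

lemma weighted_norm_inner: "weighted_norm \<rho> v = sqrt (weighted_inner \<rho> v v)"
  by (simp add: weighted_norm_def weighted_inner_def power2_eq_square)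

text \<open>All prefactors cancel: \<open>D (Suc j)\<close> is the derivative of \<open>D j\<close>
  with respect to \<open>y = Y x\<close>. As \<open>weak_deriv\<close> is total, the identity is
  formal and presupposes no differentiability.\<close>

lemma scaled_iterated_deriv:
  fixes \<theta> \<sigma> :: real and j :: nat and v :: "real \<Rightarrow> real"
  defines "D \<equiv> \<lambda>j x. x powr (- (\<gamma> * (\<theta> - \<sigma>) / 2)) * iterated_deriv \<theta> \<sigma> \<gamma> \<beta> j v x"
  assumes "x > 0"
  shows "D (Suc j) x * dY x = weak_deriv (D j) x"
proof -
  have "x powr (1 - \<gamma>) * x powr (\<gamma> - 1) = 1"
    using assms(2) by (simp add: powr_add[symmetric])
  moreover have "x powr (- (\<gamma> * (\<theta> - \<sigma>) / 2)) * x powr (\<gamma> * (\<theta> - \<sigma>) / 2) = 1"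
    using assms(2) by (simp add: powr_add[symmetric])
  ultimately have "(x powr (- (\<gamma> * (\<theta> - \<sigma>) / 2)) * x powr (\<gamma> * (\<theta> - \<sigma>) / 2)) * (x powr (1 - \<gamma>) * x powr (\<gamma> - 1)) = 1"
    by simp
  moreover have "\<gamma> * (\<beta> + 1) \<noteq> 0"
    using gamma_pos beta_gt by simp
  moreover have "a * (b * (c / d * w)) * (d * e) = (a * b) * (c * e) * w" if "d \<noteq> 0" for a b c d e w :: real
    using that by simp
  ultimately show ?thesis
    by (simp add: D_def iterated_deriv_def scaled_mapped_deriv_def mapped_deriv_def dY_def)
qed

lemma weakly_differentiable_iterated:
  fixes \<theta> \<sigma> :: real and v :: "real \<Rightarrow> real"
  defines "D \<equiv> \<lambda>j x. x powr (- (\<gamma> * (\<theta> - \<sigma>) / 2)) * iterated_deriv \<theta> \<sigma> \<gamma> \<beta> j v x"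
  assumes "weakly_differentiable (D j)"
  shows "has_weak_deriv (D j) (\<lambda>x. D (Suc j) x * dY x)"
proof -
  have "has_weak_deriv (D j) (weak_deriv (D j))"
    using assms(2) unfolding weakly_differentiable_def weak_deriv_def by (rule someI_ex)
  then show ?thesis
    by (rule has_weak_deriv_cong_AE) (auto intro!: AE_half_lineI simp: D_def scaled_iterated_deriv)
qed

text \<open>Since \<open>iterated_deriv\<close> chooses representatives, the iterates of a
  difference are not literally differences of iterates. Uniqueness of weak derivatives and
  \<open>dY > 0\<close> carry the almost everywhere equality with a known chain from one index to
  the next, and existence of the next derivative comes along.\<close>

lemma iterated_deriv_AE_eq:
  fixes \<theta> \<sigma> :: real and v :: "real \<Rightarrow> real"
  defines "D \<equiv> \<lambda>j x. x powr (- (\<gamma> * (\<theta> - \<sigma>) / 2)) * iterated_deriv \<theta> \<sigma> \<gamma> \<beta> j v x"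
  assumes E0: "AE x in Leb. D 0 x = E 0 x" and chain: "\<And>j. j < s \<Longrightarrow> has_weak_deriv (E j) (\<lambda>x. E (Suc j) x * dY x)"
  shows "j \<le> s \<Longrightarrow> AE x in Leb. D j x = E j x" "j < s \<Longrightarrow> weakly_differentiable (D j)"
proof -
  have wd: "has_weak_deriv (D j) (\<lambda>x. E (Suc j) x * dY x)" if "j < s" "AE x in Leb. D j x = E j x" for j
    using chain[OF that(1)]
    by (rule has_weak_deriv_cong_AE) (use that(2) in \<open>auto elim: eventually_mono\<close>)
  have ae: "AE x in Leb. D j x = E j x" if "j \<le> s" for j
    using that
  proof (induction j)
    case 0
    then show ?case using E0 by simp
  next
    case (Suc j)
    have 1: "has_weak_deriv (D j) (\<lambda>x. E (Suc j) x * dY x)"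
      using Suc by (intro wd) auto
    then have "weakly_differentiable (D j)"
      by (auto simp: weakly_differentiable_def)
    then have "has_weak_deriv (D j) (\<lambda>x. D (Suc j) x * dY x)"
      unfolding D_def by (rule weakly_differentiable_iterated)
    then have "AE x in Leb. D (Suc j) x * dY x = E (Suc j) x * dY x"
      using 1 by (rule has_weak_deriv_unique)
    moreover have "AE x in Leb. x > 0"
      by (rule AE_half_lineI)
    ultimately show ?case
      by eventually_elim (use dY_pos in force)
  qed
  show "j \<le> s \<Longrightarrow> AE x in Leb. D j x = E j x"
    by (rule ae)
  show "j < s \<Longrightarrow> weakly_differentiable (D j)"
    using wd[of j] ae[of j] by (auto simp: weakly_differentiable_def)
qed

section \<open>Identification of the orthogonal projection\<close>

text \<open>The powers of \<open>x\<close> are written as in \<open>P_space\<close>, so that the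
  identification with \<open>P_space\<close> is an equality of functions on all reals; the
  comparison with \<open>P q\<close> is made only for \<open>x > 0\<close>.\<close>

definition mapped_poly :: "nat \<Rightarrow> real \<Rightarrow> real poly \<Rightarrow> real \<Rightarrow> real" where
  "mapped_poly M \<eta> q x = x powr \<eta> * (\<Sum>k\<le>M. coeff q k * (\<beta> + 1) ^ k * x powr (real k * \<gamma>))"

lemma mapped_poly_eq:
  assumes "q \<in> polys (Suc M)" "x > 0"
  shows "mapped_poly M \<eta> q x = x powr \<eta> * P q x"
proof -
  have "degree q \<le> M"
    using assms(1) by (intro degree_le) (simp add: polys_def)
  then have "P q x = (\<Sum>k\<le>M. coeff q k * Y x ^ k)"
    unfolding poly_altdef by (intro sum.mono_neutral_left) (auto simp: coeff_eq_0)
  also have "\<dots> = (\<Sum>k\<le>M. coeff q k * (\<beta> + 1) ^ k * x powr (real k * \<gamma>))"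
    using assms(2) by (intro sum.cong) (simp_all add: Y_def power_mult_distrib powr_power mult_ac)
  finally show ?thesis
    by (simp add: mapped_poly_def)
qed

lemma P_space_eq: "P_space M \<eta> \<gamma> = mapped_poly M \<eta> ` polys (Suc M)"
proof (intro equalityI subsetI)
  fix w assume "w \<in> P_space M \<eta> \<gamma>"
  then obtain c where c: "w = (\<lambda>x. x powr \<eta> * (\<Sum>k\<le>M. c k * x powr (real k * \<gamma>)))"
    by (auto simp: P_space_def)
  define q where "q = (\<Sum>k\<le>M. monom (c k / (\<beta> + 1) ^ k) k)"
  have coeff_q: "coeff q k = (if k \<le> M then c k / (\<beta> + 1) ^ k else 0)" for k
    by (simp add: q_def coeff_sum)
  have "mapped_poly M \<eta> q = w"
    using beta_gt by (auto simp: mapped_poly_def c coeff_q fun_eq_iff intro!: sum.cong)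
  moreover have "q \<in> polys (Suc M)"
    by (simp add: polys_def coeff_q)
  ultimately show "w \<in> mapped_poly M \<eta> ` polys (Suc M)" by blast
next
  fix w assume "w \<in> mapped_poly M \<eta> ` polys (Suc M)"
  then show "w \<in> P_space M \<eta> \<gamma>"
    by (auto simp: P_space_def mapped_poly_def fun_eq_iff)
qed

text \<open>The definite description in \<open>proj\<close> is evaluated by existence and
  uniqueness; for the latter, the difference of two candidates is orthogonal to itself and the norm
  is positive on nonzero polynomials.\<close>

lemma proj_eq:
  fixes \<theta> \<sigma> :: real
  defines "\<eta> \<equiv> \<gamma> * (\<theta> - \<sigma>) / 2"
  assumes \<theta>: "\<theta> > -1" and u: "u \<in> weighted_L2 (weight \<theta> \<sigma> \<gamma> \<beta>)"
  obtains p where "p \<in> polys (Suc M)" "proj M \<theta> \<sigma> \<gamma> \<beta> u = mapped_poly M \<eta> p"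
    "\<And>q. q \<in> polys (Suc M) \<Longrightarrow> ip \<theta> (\<lambda>x. x powr (- \<eta>) * u x - P p x) (P q) = 0"
proof -
  define F where "F = (\<lambda>x. x powr (- \<eta>) * u x)"
  have F: "F \<in> L2 \<theta>"
    using u scaled_L2_iff[of u \<theta> 0 \<sigma>] by (simp add: F_def \<eta>_def)
  have inner: "weighted_inner (weight \<theta> \<sigma> \<gamma> \<beta>) (\<lambda>x. u x - mapped_poly M \<eta> p x) (mapped_poly M \<eta> q)
      = ip \<theta> (\<lambda>x. F x - P p x) (P q)" if "p \<in> polys (Suc M)" "q \<in> polys (Suc M)" for p q
  proof -
    have "weighted_inner (weight \<theta> \<sigma> \<gamma> \<beta>) (\<lambda>x. u x - mapped_poly M \<eta> p x) (mapped_poly M \<eta> q)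
      = ip \<theta> (\<lambda>x. x powr (- \<eta>) * (u x - mapped_poly M \<eta> p x)) (\<lambda>x. x powr (- \<eta>) * mapped_poly M \<eta> q x)"
      using scaled_inner[of \<theta> 0 \<sigma>] by (simp add: \<eta>_def)
    also have "\<dots> = ip \<theta> (\<lambda>x. F x - P p x) (P q)"
      unfolding weighted_inner_def
      by (rule Bochner_Integration.integral_cong)
        (auto simp: half_line_def F_def mapped_poly_eq[OF that(1)] mapped_poly_eq[OF that(2)] powr_minus right_diff_distrib)
    finally show ?thesis .
  qed
  obtain p where p: "p \<in> polys (Suc M)" "\<And>q. q \<in> polys (Suc M) \<Longrightarrow> ip \<theta> (\<lambda>x. F x - P p x) (P q) = 0"
    using poly_proj_exists[OF \<theta> F] by blast
  have unique: "p' = p" if p': "p' \<in> polys (Suc M)" "\<And>q. q \<in> polys (Suc M) \<Longrightarrow> ip \<theta> (\<lambda>x. F x - P p' x) (P q) = 0" for p'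
  proof (rule ccontr)
    assume "p' \<noteq> p"
    note PL = P_L2[OF \<theta>]
    have d: "p' - p \<in> polys (Suc M)"
      using p' p by (intro polys_diff)
    have "ip \<theta> (P p') (P (p' - p)) = ip \<theta> F (P (p' - p))" "ip \<theta> (P p) (P (p' - p)) = ip \<theta> F (P (p' - p))"
      using p(2)[OF d] p'(2)[OF d] by (simp_all only: ip_diff_left[OF F PL PL])
    then have "nsq \<theta> (P (p' - p)) = 0"
      using ip_diff_left[OF PL PL PL, of p' p "p' - p"] by simp
    then show False
      using nsq_P_pos[OF \<theta>, of "p' - p"] \<open>p' \<noteq> p\<close> by simp
  qed
  have "proj M \<theta> \<sigma> \<gamma> \<beta> u = mapped_poly M \<eta> p"
    unfolding proj_def \<eta>_def[symmetric] P_space_eq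
  proof (rule the_equality)
    show "mapped_poly M \<eta> p \<in> mapped_poly M \<eta> ` polys (Suc M) \<and>
        (\<forall>w\<in>mapped_poly M \<eta> ` polys (Suc M). weighted_inner (weight \<theta> \<sigma> \<gamma> \<beta>) (\<lambda>x. u x - mapped_poly M \<eta> p x) w = 0)"
      using p inner by auto
    fix w assume w: "w \<in> mapped_poly M \<eta> ` polys (Suc M) \<and>
        (\<forall>w'\<in>mapped_poly M \<eta> ` polys (Suc M). weighted_inner (weight \<theta> \<sigma> \<gamma> \<beta>) (\<lambda>x. u x - w x) w' = 0)"
    then obtain p' where p': "p' \<in> polys (Suc M)" "w = mapped_poly M \<eta> p'" by auto
    then have "ip \<theta> (\<lambda>x. F x - P p' x) (P q) = 0" if "q \<in> polys (Suc M)" for q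
      using w that inner[OF p'(1) that] by auto
    then show "w = mapped_poly M \<eta> p"
      using unique p' by blast
  qed
  with p show ?thesis
    by (intro that[of p]) (simp_all add: F_def)
qed

end

text \<open>Membership of \<open>e\<close> in \<open>A_space\<close> belongs to the conclusion
  because a non-integrable function has integral 0 and a missing derivative has an unspecified
  value: the inequality alone would not say that its left side is a genuine norm. The factorials use
  \<open>M + 1 - m\<close>, as natural subtraction would truncate \<open>M - m\<close> at
  \<open>m = M + 1\<close>.\<close>

theorem theorem3p1:
  fixes \<mu> M s m :: nat and \<theta> \<sigma> \<beta> \<gamma> :: real and u e :: "real \<Rightarrow> real"
  assumes "\<mu> \<ge> 1" and "M \<ge> 1"
    and m: "m = min \<mu> (M + 1)"
    and "s \<le> m"
    and "\<theta> > -1" and "\<beta> > -1" and "0 < \<gamma>" and "\<gamma> < 1"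
    and "u \<in> A_space \<theta> \<sigma> \<gamma> \<beta> \<mu>"
    and e: "e = (\<lambda>x. u x - proj M \<theta> \<sigma> \<gamma> \<beta> u x)"
  shows "e \<in> A_space \<theta> \<sigma> \<gamma> \<beta> s \<and>
    weighted_norm (weight (\<theta> + real s) (\<sigma> + real s) \<gamma> \<beta>) (iterated_deriv \<theta> \<sigma> \<gamma> \<beta> s e)
    \<le> sqrt (fact (M + 1 - m) / fact (M + 1 - s)) *
      weighted_norm (weight (\<theta> + real m) (\<sigma> + real m) \<gamma> \<beta>) (iterated_deriv \<theta> \<sigma> \<gamma> \<beta> m u)"
proof -
  interpret mapped_weight \<gamma> \<beta>
    using assms by unfold_locales
  define D where "D v j x = x powr (- (\<gamma> * (\<theta> - \<sigma>) / 2)) * iterated_deriv \<theta> \<sigma> \<gamma> \<beta> j v x" for v j x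
  have D_eq: "D v j = (\<lambda>x. x powr (- (\<gamma> * (\<theta> - \<sigma>) / 2)) * iterated_deriv \<theta> \<sigma> \<gamma> \<beta> j v x)" for v j
    by (simp add: D_def fun_eq_iff)
  have D_0: "D v 0 x = x powr (- (\<gamma> * (\<theta> - \<sigma>) / 2)) * v x" for v x
    by (simp add: D_def iterated_deriv_def)
  have norm_D: "weighted_norm (weight (\<theta> + real r) (\<sigma> + real r) \<gamma> \<beta>) (iterated_deriv \<theta> \<sigma> \<gamma> \<beta> r v) = sqrt (nsq (\<theta> + real r) (D v r))" for r v
    unfolding weighted_norm_inner D_eq scaled_inner[of \<theta> _ \<sigma>] ..
  have L2_D: "iterated_deriv \<theta> \<sigma> \<gamma> \<beta> r v \<in> weighted_L2 (weight (\<theta> + real r) (\<sigma> + real r) \<gamma> \<beta>) \<longleftrightarrow> D v r \<in> L2 (\<theta> + real r)" for r v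
    unfolding D_eq scaled_L2_iff[of _ \<theta> _ \<sigma>] ..
  have u: "u \<in> weighted_L2 (weight \<theta> \<sigma> \<gamma> \<beta>)"
    using assms(9) by (simp add: A_space_def)
  have uL: "D u j \<in> L2 (\<theta> + real j)" if "j \<le> m" for j
  proof (cases "j = 0")
    case True
    then show ?thesis
      using u L2_D[of 0 u] by (simp add: iterated_deriv_def)
  next
    case False
    then show ?thesis
      using assms(9) that m by (simp add: A_space_def flip: L2_D)
  qed
  have u_chain: "has_weak_deriv (D u j) (\<lambda>x. D u (Suc j) x * dY x)" if "j < m" for j
  proof -
    have "iterated_deriv_exists \<theta> \<sigma> \<gamma> \<beta> (Suc j) u"
      using assms(9) that m by (simp add: A_space_def)
    then have "weakly_differentiable (D u j)"
      by (simp add: iterated_deriv_exists_def D_eq)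
    then show ?thesis
      unfolding D_eq by (rule weakly_differentiable_iterated)
  qed
  obtain p where p: "p \<in> polys (Suc M)"
    and proj: "proj M \<theta> \<sigma> \<gamma> \<beta> u = mapped_poly M (\<gamma> * (\<theta> - \<sigma>) / 2) p"
    and orth: "\<And>q. q \<in> polys (Suc M) \<Longrightarrow> ip \<theta> (\<lambda>x. D u 0 x - P p x) (P q) = 0"
    using proj_eq[OF assms(5) u, of M] unfolding D_0 by blast
  \<comment> \<open>The chain is built from the derivatives of \<open>u\<close>; those of
    \<open>e\<close> agree with it only almost everywhere.\<close>
  define E where "E j = (\<lambda>x. D u j x - P ((pderiv ^^ j) p) x)" for j
  have EL: "E j \<in> L2 (\<theta> + real j)" if "j \<le> m" for j
    unfolding E_def using assms(5) by (intro L2_diff uL that P_L2) simp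
  have E_chain: "has_weak_deriv (E j) (\<lambda>x. E (Suc j) x * dY x)" if "j < s" for j
    using has_weak_deriv_diff[OF u_chain[of j] P_has_weak_deriv[of "(pderiv ^^ j) p"]] that assms(4)
    by (simp add: E_def left_diff_distrib)
  have E_0: "AE x in Leb. D e 0 x = E 0 x"
    by (rule AE_half_lineI) (simp add: D_0 E_def e proj mapped_poly_eq[OF p] right_diff_distrib powr_minus)
  have D_E: "AE x in Leb. E j x = D e j x" if "j \<le> s" for j
  proof -
    have "AE x in Leb. D e j x = E j x"
      using iterated_deriv_AE_eq(1)[OF E_0[unfolded D_eq] E_chain that] unfolding D_eq .
    then show ?thesis by eventually_elim simp
  qed
  have e_diff: "weakly_differentiable (D e j)" if "j < s" for j
    using iterated_deriv_AE_eq(2)[OF E_0[unfolded D_eq] E_chain that] unfolding D_eq .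
  have eL: "D e j \<in> L2 (\<theta> + real j)" if "j \<le> s" for j
    by (rule weighted_L2_cong_AE(1)[OF EL W_measurable D_E]) (use that assms(4) in auto)
  have "e \<in> A_space \<theta> \<sigma> \<gamma> \<beta> s"
    unfolding A_space_def
  proof (intro CollectI conjI allI impI)
    show "e \<in> weighted_L2 (weight \<theta> \<sigma> \<gamma> \<beta>)"
      using eL[of 0] L2_D[of 0 e] by (simp add: iterated_deriv_def)
    fix r assume r: "1 \<le> r \<and> r \<le> s"
    show "iterated_deriv_exists \<theta> \<sigma> \<gamma> \<beta> r e"
      using e_diff r by (simp add: iterated_deriv_exists_def D_eq)
    show "iterated_deriv \<theta> \<sigma> \<gamma> \<beta> r e \<in> weighted_L2 (weight (\<theta> + real r) (\<sigma> + real r) \<gamma> \<beta>)"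
      using eL r by (simp add: L2_D)
  qed
  moreover have "sqrt (nsq (\<theta> + real s) (D e s)) \<le> sqrt (fact (M + 1 - m) / fact (M + 1 - s)) * sqrt (nsq (\<theta> + real m) (D u m))"
  proof -
    \<comment> \<open>Degree at most \<open>M\<close> is \<open>polys (Suc M)\<close>, so
      \<open>n\<close> is \<open>M + 1\<close> here.\<close>
    have "fact (M + 1 - s) * nsq (\<theta> + real s) (E s) \<le> fact (M + 1 - m) * nsq (\<theta> + real m) (D u m)"
      unfolding E_def Suc_eq_plus1[symmetric]
      by (rule projection_error[OF assms(5) uL u_chain p orth _ assms(4)]) (use m in auto)
    then have "nsq (\<theta> + real s) (E s) \<le> fact (M + 1 - m) / fact (M + 1 - s) * nsq (\<theta> + real m) (D u m)"
      by (simp add: field_simps)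
    moreover have "nsq (\<theta> + real s) (D e s) = nsq (\<theta> + real s) (E s)"
      by (rule weighted_L2_cong_AE(2)[OF EL[OF assms(4)] W_measurable D_E[OF order_refl]])
    ultimately show ?thesis
      by (simp flip: real_sqrt_mult)
  qed
  ultimately show ?thesis
    by (simp add: norm_D)
qed

end
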